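(* Fix $r\ge1$, an admissible boundary $(k_{\alpha,j})$ with boundary values $a_{\alpha,j}$, and the corresponding solution $T$ of the $A_r$ $T$-system (see context). Let $\alpha\in\{1,\dots,r\}$ and $(j,k)$ with $\alpha+j+k$ even. For $1\le a,b\le\alpha$ set $$j_0(a)=\max\{j':\ j'-k_{1,j'}=j-k-2a+\alpha+1\},\qquad j_1(b)=\min\{j':\ j'+k_{1,j'}=j+k+2b-\alpha-1\},$$ and assume that for all $1\le a,b\le\alpha$ the point $(1,j-a+b,k+a+b-\alpha-1)$ satisfies $k+a+b-\alpha-1\ge k_{1,j-a+b}$ and that $j_0(a)\le j_1(b)$. Then $T_{\alpha,j,k}$ equals $\prod_{b=1}^{\alpha}T_{1,j_1(b),k_{1,j_1(b)}}$ times the sum, over all families of $\alpha$ pairwise vertex-disjoint directed paths in the network $N$ whose set of starting vertices is $\{(j_0(a),1):1\le a\le\alpha\}$ and whose set of ending vertices is $\{(j_1(b),1):1\le b\le\alpha\}$, of the product of the weights of all edges used by the family.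
   Context: $A_r$ $T$-system: for $\alpha\in\{1,\dots,r\}$, $j,k\in\mathbb Z$, $T_{\alpha,j,k+1}T_{\alpha,j,k-1}=T_{\alpha,j+1,k}T_{\alpha,j-1,k}+T_{\alpha+1,j,k}T_{\alpha-1,j,k}$, with $T_{0,j,k}=T_{r+1,j,k}=1$, on points with $\alpha+j+k$ even. Admissible boundary: integers $k_{\alpha,j}$ with $\alpha+j+k_{\alpha,j}$ even, $|k_{\alpha+1,j}-k_{\alpha,j}|=1$, $|k_{\alpha,j+1}-k_{\alpha,j}|=1$, and $k_{\alpha,j}=c+((\alpha+j)\bmod2)$ for some even $c$ and all $j$ outside a finite interval; the solution satisfies $T_{\alpha,j,k_{\alpha,j}}=a_{\alpha,j}$ and is viewed as rational functions of the $a$'s. Elementary matrices: $H_{\beta,\beta+1}(a,b,u)$ is the $(r+1)\times(r+1)$ identity except for the block $\begin{pmatrix}1&0\\ u/b&a/b\end{pmatrix}$ in rows/columns $\beta,\beta+1$; $V_{\beta,\beta+1}(x,a,b)$ likewise with block $\begin{pmatrix}a/b&x/b\\ 0&1\end{pmatrix}$. Slice matrices: for each $t$ let $a_\beta=T_{\beta,t,k_{\beta,t}}$, $b_\beta=T_{\beta,t+1,k_{\beta,t+1}}$, $a_0=b_0=a_{r+1}=b_{r+1}=1$. For $1\le\beta\le r-1$ choose in the square $Q_\beta$ with corners $(\beta,t),(\beta,t+1),(\beta+1,t),(\beta+1,t+1)$ a diagonal whose endpoints have equal $k$-values: SW–NE $=(\beta,t)$–$(\beta+1,t+1)$ or NW–SE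 $=(\beta,t+1)$–$(\beta+1,t)$. For $1\le\beta\le r$: if $k_{\beta,t+1}=k_{\beta,t}+1$, $X_\beta=H_{\beta,\beta+1}(a_\beta,b_\beta,u_\beta)$ with $u_r=1$, else $u_\beta=b_{\beta+1}$ (SW–NE in $Q_\beta$) or $a_{\beta+1}$ (NW–SE); if $k_{\beta,t+1}=k_{\beta,t}-1$, $X_\beta=V_{\beta,\beta+1}(x_\beta,a_\beta,b_\beta)$ with $x_1=1$, else $x_\beta=a_{\beta-1}$ (SW–NE in $Q_{\beta-1}$) or $b_{\beta-1}$ (NW–SE). Put $P_1=X_1$, $P_{\beta+1}=X_{\beta+1}P_\beta$ if $Q_\beta$ is SW–NE and $P_{\beta+1}=P_\beta X_{\beta+1}$ if NW–SE. This writes the slice matrix $S_t=P_r$ as an ordered product $E_{t,1}E_{t,2}\cdots E_{t,r}$ of elementary matrices. Network $N$: take integers $M_-\le\min_a j_0(a)$ and $M_+\ge\max_b j_1(b)$ and list the factors $E_{t,m}$ for $t=M_-,\dots,M_+-1$, $m=1,\dots,r$, in the order of the product $S_{M_-}\cdots S_{M_+-1}$, as $E_1,\dots,E_L$. $N$ has vertices $(\ell,x)$, $0\le\ell\le L$, $1\le x\le r+1$, and a directed edge $(\ell-1,x)\to(\ell,y)$ of weight $(E_\ell)_{x,y}$ whenever this entry is nonzero. The vertex denoted $(t,x)$ in the claim is the vertex $(\ell,x)$ where $\ell$ is the number of factors belonging to slices $M_-,\dots,t-1$ (the position between slice $t-1$ and slice $t$). Paths are directed; the weight of a family is the product of the weights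 of all its edges. *)

theory Defs
  imports
    "HOL-Library.Poly_Mapping"
    "HOL-Library.Product_Lexorder"
    "HOL-Computational_Algebra.Fraction_Field"
    "Graph_Theory.Vertex_Walk"
begin

section \<open>Rational functions in the boundary values\<close>

text \<open>
  Fractions of polynomials over \<^typ>\<open>'c\<close> in indeterminates indexed by \<^typ>\<open>nat \<times> int\<close>.
  A monomial is a finitely supported exponent function. The lexicographic order on
  \<^typ>\<open>nat \<times> int\<close> is imported only because the \<^class>\<open>idom\<close> instance for polynomials
  asks for a linear order on the indeterminates.
\<close>

type_synonym 'c ratfun = "(((nat \<times> int) \<Rightarrow>\<^sub>0 nat) \<Rightarrow>\<^sub>0 'c) fract"

definition indet :: "nat \<Rightarrow> int \<Rightarrow> 'c::field_char_0 ratfun" where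
  "indet \<alpha> j = Fraction_Field.Fract (Poly_Mapping.single (Poly_Mapping.single (\<alpha>, j) 1) 1) 1"


section \<open>The T-system and its boundaries\<close>

text \<open>
  Only the values at points with even \<open>\<alpha> + j + k\<close> are constrained; hence the relation
  centred at \<open>(\<alpha>, j, k)\<close> is required for odd \<open>\<alpha> + j + k\<close>.
\<close>

definition T_system :: "nat \<Rightarrow> (nat \<Rightarrow> int \<Rightarrow> int \<Rightarrow> 'f::field) \<Rightarrow> bool" where
  "T_system r T \<longleftrightarrow>
     (\<forall>\<alpha>\<in>{0, r + 1}. \<forall>j k. even (int \<alpha> + j + k) \<longrightarrow> T \<alpha> j k = 1) \<and>
     (\<forall>\<alpha>\<in>{1..r}. \<forall>j k. odd (int \<alpha> + j + k) \<longrightarrow>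
        T \<alpha> j (k + 1) * T \<alpha> j (k - 1) =
          T \<alpha> (j + 1) k * T \<alpha> (j - 1) k + T (\<alpha> + 1) j k * T (\<alpha> - 1) j k)"

definition admissible_boundary :: "nat \<Rightarrow> (nat \<Rightarrow> int \<Rightarrow> int) \<Rightarrow> bool" where
  "admissible_boundary r \<kappa> \<longleftrightarrow>
     (\<forall>\<alpha>\<in>{1..r}. \<forall>j. even (int \<alpha> + j + \<kappa> \<alpha> j)) \<and>
     (\<forall>\<alpha>\<in>{1..<r}. \<forall>j. \<bar>\<kappa> (\<alpha> + 1) j - \<kappa> \<alpha> j\<bar> = 1) \<and>
     (\<forall>\<alpha>\<in>{1..r}. \<forall>j. \<bar>\<kappa> \<alpha> (j + 1) - \<kappa> \<alpha> j\<bar> = 1) \<and>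
     (\<exists>c lo hi. even c \<and>
        (\<forall>\<alpha>\<in>{1..r}. \<forall>j. j \<notin> {lo..hi} \<longrightarrow> \<kappa> \<alpha> j = c + (int \<alpha> + j) mod 2))"


section \<open>Slice matrices\<close>

text \<open>
  Matrices of size \<open>(r+1) \<times> (r+1)\<close> are functions of a row and a column index, both
  counted from 1; entries at indices outside \<open>{1..r+1}\<close> are never used.
\<close>

type_synonym 'f matrix = "nat \<Rightarrow> nat \<Rightarrow> 'f"

definition elem_H :: "nat \<Rightarrow> 'f \<Rightarrow> 'f \<Rightarrow> 'f \<Rightarrow> 'f::field matrix" where
  "elem_H \<beta> a b u x y =
     (if x = \<beta> + 1 \<and> y = \<beta> then u / b
      else if x = \<beta> + 1 \<and> y = \<beta> + 1 then a / b
      else if x = y then 1 else 0)"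

definition elem_V :: "nat \<Rightarrow> 'f \<Rightarrow> 'f \<Rightarrow> 'f \<Rightarrow> 'f::field matrix" where
  "elem_V \<beta> v a b x y =
     (if x = \<beta> \<and> y = \<beta> then a / b
      else if x = \<beta> \<and> y = \<beta> + 1 then v / b
      else if x = y then 1 else 0)"

datatype diagonal = SW_NE | NW_SE

text \<open>
  \<open>d \<beta> t\<close> is the diagonal chosen in the square with corners
  \<open>(\<beta>, t)\<close>, \<open>(\<beta>, t + 1)\<close>, \<open>(\<beta> + 1, t)\<close>, \<open>(\<beta> + 1, t + 1)\<close>.
\<close>

definition admissible_diagonals ::
    "nat \<Rightarrow> (nat \<Rightarrow> int \<Rightarrow> int) \<Rightarrow> (nat \<Rightarrow> int \<Rightarrow> diagonal) \<Rightarrow> bool" where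
  "admissible_diagonals r \<kappa> d \<longleftrightarrow>
     (\<forall>\<beta>\<in>{1..<r}. \<forall>t. case d \<beta> t of
        SW_NE \<Rightarrow> \<kappa> \<beta> t = \<kappa> (\<beta> + 1) (t + 1)
      | NW_SE \<Rightarrow> \<kappa> \<beta> (t + 1) = \<kappa> (\<beta> + 1) t)"

context
  fixes r :: nat
    and \<kappa> :: "nat \<Rightarrow> int \<Rightarrow> int"
    and T :: "nat \<Rightarrow> int \<Rightarrow> int \<Rightarrow> 'f::field"
    and d :: "nat \<Rightarrow> int \<Rightarrow> diagonal"
begin

definition bval :: "nat \<Rightarrow> int \<Rightarrow> 'f" where
  "bval \<beta> t = (if \<beta> = 0 \<or> \<beta> = r + 1 then 1 else T \<beta> t (\<kappa> \<beta> t))"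

definition slice_elem :: "int \<Rightarrow> nat \<Rightarrow> 'f matrix" where
  "slice_elem t \<beta> =
     (if \<kappa> \<beta> (t + 1) = \<kappa> \<beta> t + 1
      then elem_H \<beta> (bval \<beta> t) (bval \<beta> (t + 1))
             (if \<beta> = r then 1
              else case d \<beta> t of
                SW_NE \<Rightarrow> bval (\<beta> + 1) (t + 1)
              | NW_SE \<Rightarrow> bval (\<beta> + 1) t)
      else elem_V \<beta>
             (if \<beta> = 1 then 1
              else case d (\<beta> - 1) t of
                SW_NE \<Rightarrow> bval (\<beta> - 1) t
              | NW_SE \<Rightarrow> bval (\<beta> - 1) (t + 1))
             (bval \<beta> t) (bval \<beta> (t + 1)))"

text \<open>
  \<open>slice_partial t \<beta>\<close> is the ordered list of the factors of the product \<open>P\<^sub>\<beta>\<close>: left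
  multiplication by the next factor prepends it, right multiplication appends it.
\<close>

fun slice_partial :: "int \<Rightarrow> nat \<Rightarrow> 'f matrix list" where
  "slice_partial t 0 = []"
| "slice_partial t (Suc 0) = [slice_elem t 1]"
| "slice_partial t (Suc (Suc \<beta>)) =
     (case d (Suc \<beta>) t of
        SW_NE \<Rightarrow> slice_elem t (Suc (Suc \<beta>)) # slice_partial t (Suc \<beta>)
      | NW_SE \<Rightarrow> slice_partial t (Suc \<beta>) @ [slice_elem t (Suc (Suc \<beta>))])"

text \<open>The factors of the slice matrices with index \<open>t\<close>, \<open>s \<le> t < t'\<close>, in order.\<close>

definition slice_factors :: "int \<Rightarrow> int \<Rightarrow> 'f matrix list" where
  "slice_factors s t' = concat (map (\<lambda>t. slice_partial t r) [s..t' - 1])"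

end


section \<open>The network\<close>

text \<open>
  The factor \<open>E\<^sub>\<ell>\<close> in the usual 1-based numbering is \<open>Es ! (\<ell> - 1)\<close>, so an edge from
  layer \<open>\<ell>\<close> to layer \<open>\<ell> + 1\<close> belongs to \<open>Es ! \<ell>\<close>.
\<close>

definition network ::
    "nat \<Rightarrow> 'f::field matrix list \<Rightarrow> (nat \<times> nat, (nat \<times> nat) \<times> (nat \<times> nat)) pre_digraph" where
  "network r Es =
     \<lparr> verts = {0..length Es} \<times> {1..r + 1},
       arcs = {((l, x), (l + 1, y)) | l x y.
                 l < length Es \<and> x \<in> {1..r + 1} \<and> y \<in> {1..r + 1} \<and> (Es ! l) x y \<noteq> 0},
       tail = fst, head = snd \<rparr>"

definition edge_weight :: "'f::field matrix list \<Rightarrow> (nat \<times> nat) \<times> (nat \<times> nat) \<Rightarrow> 'f" where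
  "edge_weight Es e = (Es ! fst (fst e)) (snd (fst e)) (snd (snd e))"

definition family_weight :: "'f::field matrix list \<Rightarrow> (nat \<times> nat) vwalk set \<Rightarrow> 'f" where
  "family_weight Es F = (\<Prod>p\<in>F. \<Prod>e\<leftarrow>vwalk_arcs p. edge_weight Es e)"

definition disjoint_path_families ::
    "('v, 'e) pre_digraph \<Rightarrow> nat \<Rightarrow> 'v set \<Rightarrow> 'v set \<Rightarrow> 'v vwalk set set" where
  "disjoint_path_families G n A B =
     {F. finite F \<and> card F = n \<and> (\<forall>p\<in>F. vpath p G) \<and>
         pairwise (\<lambda>p q. disjnt (set p) (set q)) F \<and>
         hd ` F = A \<and> last ` F = B}"


section \<open>End points of the paths\<close>

definition j0 :: "(nat \<Rightarrow> int \<Rightarrow> int) \<Rightarrow> nat \<Rightarrow> int \<Rightarrow> int \<Rightarrow> nat \<Rightarrow> int" where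
  "j0 \<kappa> \<alpha> j k a = Max {j'. j' - \<kappa> 1 j' = j - k - 2 * int a + int \<alpha> + 1}"

definition j1 :: "(nat \<Rightarrow> int \<Rightarrow> int) \<Rightarrow> nat \<Rightarrow> int \<Rightarrow> int \<Rightarrow> nat \<Rightarrow> int" where
  "j1 \<kappa> \<alpha> j k b = Min {j'. j' + \<kappa> 1 j' = j + k + 2 * int b - int \<alpha> - 1}"

end

theory Submission
  imports Defs "Jordan_Normal_Form.Determinant"
begin

text \<open>
  All values of \<open>T\<close> are subtraction-free in the boundary values, hence nonzero, so Dodgson
  condensation shows that \<open>T\<^sub>n\<close> is a contiguous \<open>n \<times> n\<close> minor of the matrix formed by the values
  \<open>T\<^sub>1\<close>. Each boundary time \<open>t\<close> determines a vector of minors bordered by one further column \<open>y\<close> of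
  this matrix, and three-term relations between such minors show that the elementary factors of the
  slice matrix at \<open>t\<close> carry the vector of \<open>t + 1\<close> to that of \<open>t\<close>. For the column attached to the
  boundary point \<open>(1, t)\<close> the vector at \<open>t\<close> is a multiple of the first unit vector, so the path sums
  between the vertices \<open>(s, 1)\<close> and \<open>(t, 1)\<close>, times the boundary value at \<open>(1, t)\<close>, are values of
  \<open>T\<^sub>1\<close>. Finally the families of disjoint paths are counted by a determinant of path sums, as in the
  lemma of Lindstroem, Gessel and Viennot: both sides satisfy the same recursion under moving one
  starting vertex forward.
\<close>


section \<open>Contiguous minors and their bordered variants\<close>

text \<open>The border column \<open>y\<close> is a free parameter: the factors transport the vector
  for every \<open>y\<close>, and \<open>y\<close> is fixed only at the end, as the column of the
  boundary point at which a path stops. Component \<open>x\<close> takes its rows from the minor at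
  boundary row \<open>x\<close> and its columns from the minor at boundary row \<open>x - 1\<close>.
  Passing one boundary row from time \<open>t + 1\<close> to \<open>t\<close> shifts a single
  coordinate of the corner of its minor and so changes a single component; the relation this
  produces is one elementary factor. The diagonals encode the order of these passes. The top
  component has no boundary row to take its rows from; there all minors of size \<open>r + 1\<close>
  equal 1, which makes the choice of rows immaterial. Nonvanishing serves not only for division but
  also to prove the three-term relations: a functional that kills all columns of an invertible block
  is zero. In the path count, starts are not matched to ends in advance; the rows of the determinant
  are kept in planar order, so every reached end is split off in first position and no permutation
  has to be tracked.\<close>

definition contig :: "(int \<Rightarrow> int \<Rightarrow> 'f::field) \<Rightarrow> nat \<Rightarrow> int \<Rightarrow> int \<Rightarrow> 'f" where
  "contig M n i l = det (mat n n (\<lambda>(s, t). M (i + int s) (l + int t)))"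

text \<open>The columns of \<open>M\<close> that enter are \<open>l\<close> to
  \<open>l + n - 2\<close>; for \<open>n = 1\<close> there are none and \<open>l\<close> is
  irrelevant.\<close>

definition bordered ::
    "(int \<Rightarrow> int \<Rightarrow> 'f::field) \<Rightarrow> nat \<Rightarrow> int \<Rightarrow> int \<Rightarrow> (int \<Rightarrow> 'f) \<Rightarrow> 'f" where
  "bordered M n i l u =
     det (mat n n (\<lambda>(s, t). if Suc t = n then u (i + int s) else M (i + int s) (l + int t)))"

definition border_cofactor ::
    "(int \<Rightarrow> int \<Rightarrow> 'f::field) \<Rightarrow> nat \<Rightarrow> int \<Rightarrow> int \<Rightarrow> nat \<Rightarrow> 'f" where
  "border_cofactor M n i l s =
     (-1) ^ (s + n) * det (mat n n (\<lambda>(a, t). M (i + int (insert_index s a)) (l + int t)))"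

lemma contig_0 [simp]: "contig M 0 i l = 1"
  by (simp add: contig_def)

lemma contig_1 [simp]: "contig M (Suc 0) i l = M i l"
  unfolding contig_def by (subst det_single) auto

lemma bordered_1 [simp]: "bordered M (Suc 0) i l u = u i"
  unfolding bordered_def by (subst det_single) auto

lemma bordered_expand:
  "bordered M (Suc n) i l u = (\<Sum>s<Suc n. border_cofactor M n i l s * u (i + int s))"
proof -
  let ?A = "mat (Suc n) (Suc n)
    (\<lambda>(s, t). if Suc t = Suc n then u (i + int s) else M (i + int s) (l + int t))"
  have "bordered M (Suc n) i l u = (\<Sum>s<Suc n. ?A $$ (s, n) * cofactor ?A s n)"
    unfolding bordered_def by (rule laplace_expansion_column) auto
  also have "\<dots> = (\<Sum>s<Suc n. border_cofactor M n i l s * u (i + int s))"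
  proof (rule sum.cong)
    fix s assume s: "s \<in> {..<Suc n}"
    have "mat_delete ?A s n = mat n n (\<lambda>(a, t). M (i + int (insert_index s a)) (l + int t))"
      using s by (intro eq_matI) (auto simp: mat_delete_def insert_index_def)
    then show "?A $$ (s, n) * cofactor ?A s n = border_cofactor M n i l s * u (i + int s)"
      using s by (simp add: cofactor_def border_cofactor_def)
  qed simp
  finally show ?thesis .
qed

lemma border_cofactor_last: "border_cofactor M n i l n = contig M n i l"
proof -
  have "mat n n (\<lambda>(a, t). M (i + int (insert_index n a)) (l + int t)) =
        mat n n (\<lambda>(a, t). M (i + int a) (l + int t))"
    by (intro eq_matI) (auto simp: insert_index_def)
  then show ?thesis
    by (simp add: border_cofactor_def contig_def)
qed

lemma border_cofactor_first: "border_cofactor M n i l 0 = (-1) ^ n * contig M n (i + 1) l"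
proof -
  have "mat n n (\<lambda>(a, t). M (i + int (insert_index 0 a)) (l + int t)) =
        mat n n (\<lambda>(a, t). M (i + 1 + int a) (l + int t))"
    by (intro eq_matI) (auto simp: insert_index_def algebra_simps)
  then show ?thesis
    by (simp add: border_cofactor_def contig_def)
qed

lemma bordered_column_eq_0:
  assumes "l \<le> y" "y < l + int n"
  shows "bordered M (Suc n) i l (\<lambda>\<rho>. M \<rho> y) = 0"
proof -
  let ?A = "mat (Suc n) (Suc n)
    (\<lambda>(s, t). if Suc t = Suc n then M (i + int s) y else M (i + int s) (l + int t))"
  obtain t where t: "y = l + int t" "t < n"
    using assms by (metis add_less_cancel_left nonneg_int_cases of_nat_less_iff zle_iff_zadd)
  have "det ?A = 0"
  proof (rule det_identical_columns)
    show "?A \<in> carrier_mat (Suc n) (Suc n)" "t \<noteq> n" "t < Suc n" "n < Suc n"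
      using t by auto
    show "col ?A t = col ?A n"
      using t by (intro eq_vecI) auto
  qed
  then show ?thesis
    by (simp add: bordered_def)
qed

lemma bordered_next_column:
  assumes "y = l + int n"
  shows "bordered M (Suc n) i l (\<lambda>\<rho>. M \<rho> y) = contig M (Suc n) i l"
  unfolding bordered_def contig_def
  by (rule arg_cong[where f = det], rule eq_matI) (use assms in auto)

text \<open>\<open>c\<close> is a row vector annihilating an invertible block. This is the
  uniqueness principle by which identities linear in a border column are tested on few
  columns.\<close>

lemma functional_eq_0:
  fixes c :: "nat \<Rightarrow> 'f::field"
  assumes "contig M n i l \<noteq> 0"
    and "\<And>t. t < n \<Longrightarrow> (\<Sum>s<n. c s * M (i + int s) (l + int t)) = 0"
    and "s < n"
  shows "c s = 0"
proof -
  let ?A = "mat n n (\<lambda>(s, t). M (i + int s) (l + int t))"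
  have A: "transpose_mat ?A \<in> carrier_mat n n"
    by simp
  have "det (transpose_mat ?A) \<noteq> 0"
    using assms(1) by (subst det_transpose[where n = n]) (auto simp: contig_def)
  moreover have "transpose_mat ?A *\<^sub>v vec n c = 0\<^sub>v n"
    using assms(2)
    by (intro eq_vecI) (auto simp: scalar_prod_def mult.commute lessThan_atLeast0)
  moreover have "vec n c \<in> carrier_vec n"
    by simp
  ultimately have "vec n c = 0\<^sub>v n"
    using det_0_iff_vec_prod_zero_field[OF A] by blast
  then show ?thesis
    using assms(3) by (metis index_vec index_zero_vec(1))
qed

text \<open>
  Both three-term relations compare linear functionals of the last column \<open>u\<close>: they agree on
  enough columns of \<open>M\<close> and unit vectors to coincide.
\<close>

lemma bordered_relation_V:
  assumes nz: "contig M m (i + 1) l0 \<noteq> 0" and l0: "l0 = l \<or> l0 = l + 1"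
  shows "contig M (Suc m) i l * bordered M (Suc m) (i + 1) l0 u =
    contig M m (i + 1) l0 * bordered M (Suc (Suc m)) i l u +
    contig M (Suc m) (i + 1) l * bordered M (Suc m) i l0 u"
proof -
  define A where "A = contig M (Suc m) i l"
  define B where "B = contig M m (i + 1) l0"
  define C where "C = contig M (Suc m) (i + 1) l"
  \<comment> \<open>\<open>p\<close>, \<open>q\<close> and \<open>w\<close> are the coefficient
    vectors of the three bordered minors on the common rows \<open>i\<close> to
    \<open>i + m + 1\<close>, padded by 0 where a minor misses a row.\<close>
  define p where "p s = (if s = 0 then 0 else border_cofactor M m (i + 1) l0 (s - 1))" for s
  define q where "q s = border_cofactor M (Suc m) i l s" for s
  define w where "w s = (if s < Suc m then border_cofactor M m i l0 s else 0)" for s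
  define c where "c s = A * p s - B * q s - C * w s" for s
  have e1: "bordered M (Suc m) (i + 1) l0 u = (\<Sum>s<Suc (Suc m). p s * u (i + int s))" for u
    by (subst sum.lessThan_Suc_shift) (simp add: p_def bordered_expand algebra_simps del: sum.lessThan_Suc)
  have e2: "bordered M (Suc (Suc m)) i l u = (\<Sum>s<Suc (Suc m). q s * u (i + int s))" for u
    by (simp add: q_def bordered_expand del: sum.lessThan_Suc)
  have e3: "bordered M (Suc m) i l0 u = (\<Sum>s<Suc (Suc m). w s * u (i + int s))" for u
  proof -
    have "(\<Sum>s<Suc (Suc m). w s * u (i + int s)) = (\<Sum>s<Suc m. w s * u (i + int s))"
      by (simp add: w_def)
    also have "\<dots> = (\<Sum>s<Suc m. border_cofactor M m i l0 s * u (i + int s))"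
      by (rule sum.cong) (auto simp: w_def)
    finally show ?thesis by (simp add: bordered_expand)
  qed
  have expand: "A * bordered M (Suc m) (i + 1) l0 u - B * bordered M (Suc (Suc m)) i l u
      - C * bordered M (Suc m) i l0 u = (\<Sum>s<Suc (Suc m). c s * u (i + int s))" for u
    unfolding e1 e2 e3 c_def
    by (simp only: sum_distrib_left sum_subtractf[symmetric] algebra_simps)
  \<comment> \<open>In the two outermost rows the cofactors are contiguous minors up to sign and
    cancel in pairs. The \<open>m\<close> inner rows are those of the nonzero minor
    \<open>B\<close>.\<close>
  have c0: "c 0 = 0"
    by (simp add: c_def p_def q_def w_def border_cofactor_first A_def B_def C_def)
  have cm: "c (Suc m) = 0"
    by (simp add: c_def p_def q_def w_def border_cofactor_last A_def B_def C_def)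
  have zero: "c (Suc s) = 0" if "s < m" for s
  proof (rule functional_eq_0[OF nz, where c = "\<lambda>s. c (Suc s)", OF _ that])
    fix t assume t: "t < m"
    let ?u = "\<lambda>\<rho>. M \<rho> (l0 + int t)"
    \<comment> \<open>All three minors already contain column \<open>l0 + t\<close>; for the largest
      one this needs \<open>l0\<close> to be \<open>l\<close> or \<open>l + 1\<close>.\<close>
    have "bordered M (Suc m) (i + 1) l0 ?u = 0" "bordered M (Suc (Suc m)) i l ?u = 0"
      "bordered M (Suc m) i l0 ?u = 0"
      using t l0 by (auto intro!: bordered_column_eq_0)
    then have "(\<Sum>s<Suc (Suc m). c s * ?u (i + int s)) = 0"
      using expand[of ?u] by simp
    then have "(\<Sum>s<Suc m. c (Suc s) * ?u (i + int (Suc s))) = 0"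
      by (subst (asm) sum.lessThan_Suc_shift) (simp add: c0)
    then show "(\<Sum>s<m. c (Suc s) * M (i + 1 + int s) (l0 + int t)) = 0"
      by (simp add: cm algebra_simps)
  qed
  have "c s = 0" if "s < Suc (Suc m)" for s
    using that zero c0 cm by (cases s) (auto simp: less_Suc_eq)
  then have "(\<Sum>s<Suc (Suc m). c s * u (i + int s)) = 0"
    by (intro sum.neutral) auto
  then show ?thesis
    using expand[of u] by (simp add: A_def B_def C_def algebra_simps)
qed

lemma bordered_relation_H:
  assumes nz: "contig M (Suc m) i (l + 1) \<noteq> 0" and i': "i' = i \<or> i' = i - 1"
  shows "contig M (Suc m) i (l + 1) * bordered M (Suc (Suc m)) i' l u =
    contig M (Suc (Suc m)) i' l * bordered M (Suc m) i (l + 1) u +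
    contig M (Suc m) i l * bordered M (Suc (Suc m)) i' (l + 1) u"
proof -
  define A where "A = contig M (Suc m) i (l + 1)"
  define B where "B = contig M (Suc (Suc m)) i' l"
  define C where "C = contig M (Suc m) i l"
  define e where "e = nat (i - i')"
  have e: "i = i' + int e" "e = 0 \<or> e = 1"
    using i' by (auto simp: e_def)
  define p where "p s = border_cofactor M (Suc m) i' l s" for s
  define q where
    "q s = (if e \<le> s \<and> s < e + Suc m then border_cofactor M m i (l + 1) (s - e) else 0)" for s
  define w where "w s = border_cofactor M (Suc m) i' (l + 1) s" for s
  define c where "c s = A * p s - B * q s - C * w s" for s
  \<comment> \<open>The nonzero minor covers the \<open>m + 1\<close> rows from \<open>i\<close> on.
    The one remaining row is at the bottom for \<open>e = 0\<close> and at the top for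
    \<open>e = 1\<close>; splitting it off treats both cases at once.\<close>
  have shift: "(\<Sum>s<Suc (Suc m). f s) = (\<Sum>s<Suc m. f (e + s)) + f (if e = 0 then Suc m else 0)"
    for f :: "nat \<Rightarrow> 'a"
  proof (cases "e = 0")
    case False
    then have "e = 1" using e by simp
    then show ?thesis
      by (subst sum.lessThan_Suc_shift) (simp add: algebra_simps del: sum.lessThan_Suc)
  qed simp
  have e1: "bordered M (Suc (Suc m)) i' l u = (\<Sum>s<Suc (Suc m). p s * u (i' + int s))" for u
    by (simp add: p_def bordered_expand del: sum.lessThan_Suc)
  have e3: "bordered M (Suc (Suc m)) i' (l + 1) u = (\<Sum>s<Suc (Suc m). w s * u (i' + int s))" for u
    by (simp add: w_def bordered_expand del: sum.lessThan_Suc)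
  have e2: "bordered M (Suc m) i (l + 1) u = (\<Sum>s<Suc (Suc m). q s * u (i' + int s))" for u
    unfolding shift bordered_expand
    using e(2) by (simp add: q_def e(1) add.assoc del: sum.lessThan_Suc)
  have expand: "A * bordered M (Suc (Suc m)) i' l u - B * bordered M (Suc m) i (l + 1) u
      - C * bordered M (Suc (Suc m)) i' (l + 1) u = (\<Sum>s<Suc (Suc m). c s * u (i' + int s))" for u
    unfolding e1 e2 e3 c_def
    by (simp only: sum_distrib_left sum_subtractf[symmetric] algebra_simps)
  have c0: "c (if e = 0 then Suc m else 0) = 0"
    using e by (auto simp: c_def p_def q_def w_def border_cofactor_first border_cofactor_last
        A_def B_def C_def)
  have zero: "c (e + s) = 0" if "s < Suc m" for s
  proof (rule functional_eq_0[OF nz, where c = "\<lambda>s. c (e + s)", OF _ that])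
    fix t assume t: "t < Suc m"
    let ?u = "\<lambda>\<rho>. M \<rho> (l + 1 + int t)"
    have "A * bordered M (Suc (Suc m)) i' l ?u - B * bordered M (Suc m) i (l + 1) ?u
      - C * bordered M (Suc (Suc m)) i' (l + 1) ?u = 0"
    \<comment> \<open>Column \<open>l + m + 1\<close> does not repeat in the first two minors, but
      there they evaluate to \<open>B\<close> and \<open>A\<close>, and \<open>A * B - B * A\<close>
      cancels.\<close>
    proof (cases "t = m")
      case True
      have "bordered M (Suc (Suc m)) i' l ?u = B" "bordered M (Suc m) i (l + 1) ?u = A"
        unfolding A_def B_def by (rule bordered_next_column; simp add: True)+
      moreover have "bordered M (Suc (Suc m)) i' (l + 1) ?u = 0"
        using t by (intro bordered_column_eq_0) auto
      ultimately show ?thesis by simp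
    next
      case False
      then have "bordered M (Suc (Suc m)) i' l ?u = 0" "bordered M (Suc m) i (l + 1) ?u = 0"
        "bordered M (Suc (Suc m)) i' (l + 1) ?u = 0"
        using t by (auto intro!: bordered_column_eq_0)
      then show ?thesis by simp
    qed
    then have "(\<Sum>s<Suc (Suc m). c s * ?u (i' + int s)) = 0"
      using expand[of ?u] by simp
    then have "(\<Sum>s<Suc m. c (e + s) * ?u (i' + int (e + s))) = 0"
      unfolding shift c0 by simp
    then show "(\<Sum>s<Suc m. c (e + s) * M (i + int s) (l + 1 + int t)) = 0"
      by (simp add: e(1) add.assoc del: sum.lessThan_Suc)
  qed
  have "(\<Sum>s<Suc (Suc m). c s * u (i' + int s)) = 0"
    unfolding shift c0 using zero by (simp del: sum.lessThan_Suc)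
  then show ?thesis
    using expand[of u] by (simp add: A_def B_def C_def algebra_simps)
qed


section \<open>Solutions of the T-system do not vanish\<close>

text \<open>
  The coefficient field need not be ordered, so positivity means natural coefficients in both
  numerator and denominator.
\<close>

definition nat_coeffs :: "(((nat \<times> int) \<Rightarrow>\<^sub>0 nat) \<Rightarrow>\<^sub>0 'c::field_char_0) \<Rightarrow> bool" where
  "nat_coeffs p \<longleftrightarrow> p \<noteq> 0 \<and> (\<forall>m. Poly_Mapping.lookup p m \<in> \<nat>)"

definition subtraction_free :: "'c::field_char_0 ratfun \<Rightarrow> bool" where
  "subtraction_free x \<longleftrightarrow> (\<exists>p q. nat_coeffs p \<and> nat_coeffs q \<and> x = Fraction_Field.Fract p q)"

lemma Nats_Sum_any:
  assumes "\<And>i. f i \<in> \<nat>"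
  shows "Sum_any f \<in> \<nat>"
proof -
  have "sum f A \<in> \<nat>" for A
    using assms by (induction A rule: infinite_finite_induct) auto
  then show ?thesis by (simp add: Sum_any.expand_set)
qed

text \<open>Characteristic zero enters here: a nonzero natural coefficient cannot be cancelled by
  adding another natural one.\<close>

lemma nat_coeffs_add:
  assumes "nat_coeffs p" "nat_coeffs q"
  shows "nat_coeffs (p + q)"
proof -
  obtain m where m: "Poly_Mapping.lookup p m \<noteq> 0"
    using assms(1) by (metis nat_coeffs_def poly_mapping_eqI lookup_zero)
  obtain a b where ab: "Poly_Mapping.lookup p m = of_nat a" "Poly_Mapping.lookup q m = of_nat b"
    using assms by (meson Nats_cases nat_coeffs_def)
  then have "Poly_Mapping.lookup (p + q) m = of_nat (a + b)"
    by (simp add: lookup_add)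
  moreover have "a \<noteq> 0"
    using m ab by (metis of_nat_0)
  ultimately have "Poly_Mapping.lookup (p + q) m \<noteq> 0"
    by (metis add_is_0 of_nat_eq_0_iff)
  then have "p + q \<noteq> 0"
    by force
  then show ?thesis
    using assms by (auto simp: nat_coeffs_def lookup_add)
qed

lemma nat_coeffs_mult:
  assumes "nat_coeffs p" "nat_coeffs q"
  shows "nat_coeffs (p * q)"
proof -
  have "Poly_Mapping.lookup (p * q) m \<in> \<nat>" for m
    using assms unfolding lookup_mult nat_coeffs_def
    by (intro Nats_Sum_any Nats_mult) (auto simp: when_def)
  then show ?thesis
    using assms by (simp add: nat_coeffs_def)
qed

lemma nat_coeffs_single: "nat_coeffs (Poly_Mapping.single m 1)"
proof -
  have "Poly_Mapping.single m (1::'a) \<noteq> 0"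
    by (metis lookup_single_eq lookup_zero zero_neq_one)
  then show ?thesis
    by (auto simp: nat_coeffs_def lookup_single when_def)
qed

lemma subtraction_free_indet: "subtraction_free (indet \<alpha> j)"
  using nat_coeffs_single[of 0] nat_coeffs_single[of "Poly_Mapping.single (\<alpha>, j) 1"]
  unfolding subtraction_free_def indet_def by (metis single_one)

lemma subtraction_free_one: "subtraction_free 1"
  using nat_coeffs_single[of 0] unfolding subtraction_free_def
  by (metis single_one One_fract_def)

lemma subtraction_free_add:
  assumes "subtraction_free x" "subtraction_free y"
  shows "subtraction_free (x + y)"
proof -
  obtain p q p' q' where *: "nat_coeffs p" "nat_coeffs q" "nat_coeffs p'" "nat_coeffs q'"
    "x = Fraction_Field.Fract p q" "y = Fraction_Field.Fract p' q'"
    using assms by (auto simp: subtraction_free_def)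
  then have "x + y = Fraction_Field.Fract (p * q' + p' * q) (q * q')"
    by (simp add: nat_coeffs_def)
  moreover have "nat_coeffs (p * q' + p' * q)" "nat_coeffs (q * q')"
    by (intro nat_coeffs_add nat_coeffs_mult *)+
  ultimately show ?thesis
    unfolding subtraction_free_def by blast
qed

lemma subtraction_free_mult:
  assumes "subtraction_free x" "subtraction_free y"
  shows "subtraction_free (x * y)"
proof -
  obtain p q p' q' where *: "nat_coeffs p" "nat_coeffs q" "nat_coeffs p'" "nat_coeffs q'"
    "x = Fraction_Field.Fract p q" "y = Fraction_Field.Fract p' q'"
    using assms by (auto simp: subtraction_free_def)
  then have "x * y = Fraction_Field.Fract (p * p') (q * q')"
    by simp
  moreover have "nat_coeffs (p * p')" "nat_coeffs (q * q')"
    by (intro nat_coeffs_mult *)+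
  ultimately show ?thesis
    unfolding subtraction_free_def by blast
qed

lemma subtraction_free_nonzero: "subtraction_free x \<Longrightarrow> x \<noteq> 0"
  by (auto simp: subtraction_free_def nat_coeffs_def Zero_fract_def eq_fract)

lemma subtraction_free_divide:
  assumes "subtraction_free x" "subtraction_free y"
  shows "subtraction_free (x / y)"
proof -
  obtain p q where *: "nat_coeffs p" "nat_coeffs q" "y = Fraction_Field.Fract p q"
    using assms by (auto simp: subtraction_free_def)
  then have "inverse y = Fraction_Field.Fract q p"
    by simp
  then have "subtraction_free (inverse y)"
    using * by (metis subtraction_free_def)
  then show ?thesis
    using assms(1) subtraction_free_mult by (metis divide_inverse)
qed

text \<open>Serves to solve a T-relation for one factor of its left-hand side.\<close>

lemma subtraction_free_other_factor:
  assumes "x * y = z" "subtraction_free y" "subtraction_free z"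
  shows "subtraction_free x"
  using assms subtraction_free_divide subtraction_free_nonzero nonzero_mult_div_cancel_right
  by metis

section \<open>Positivity propagated away from the boundary\<close>

lemma admissible_boundary_bounded:
  assumes "admissible_boundary r \<kappa>"
  obtains B where "\<And>\<alpha> j. \<alpha> \<in> {1..r} \<Longrightarrow> \<bar>\<kappa> \<alpha> j\<bar> \<le> B"
proof -
  obtain c lo hi where out: "\<forall>\<alpha>\<in>{1..r}. \<forall>j. j \<notin> {lo..hi} \<longrightarrow> \<kappa> \<alpha> j = c + (int \<alpha> + j) mod 2"
    using assms unfolding admissible_boundary_def by blast
  let ?S = "insert (\<bar>c\<bar> + 1) ((\<lambda>(\<alpha>, j). \<bar>\<kappa> \<alpha> j\<bar>) ` ({1..r} \<times> {lo..hi}))"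
  have fin: "finite ?S" by simp
  have "\<bar>\<kappa> \<alpha> j\<bar> \<le> Max ?S" if \<alpha>: "\<alpha> \<in> {1..r}" for \<alpha> j
  proof (cases "j \<in> {lo..hi}")
    case True
    then have "\<bar>\<kappa> \<alpha> j\<bar> \<in> ?S" using \<alpha> by force
    then show ?thesis using fin Max_ge by blast
  next
    case False
    then have "\<kappa> \<alpha> j = c + (int \<alpha> + j) mod 2" using out \<alpha> by blast
    then have "\<bar>\<kappa> \<alpha> j\<bar> \<le> \<bar>c\<bar> + 1"
      using pos_mod_bound[of 2 "int \<alpha> + j"] pos_mod_sign[of 2 "int \<alpha> + j"] by linarith
    moreover have "\<bar>c\<bar> + 1 \<le> Max ?S" using fin by (intro Max_ge) auto
    ultimately show ?thesis by linarith
  qed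
  then show ?thesis using that by blast
qed

context
  fixes r :: nat
    and \<kappa> :: "nat \<Rightarrow> int \<Rightarrow> int"
    and T :: "nat \<Rightarrow> int \<Rightarrow> int \<Rightarrow> 'c::field_char_0 ratfun"
    and B :: int
  assumes kappa_parity: "\<And>\<alpha> j. \<alpha> \<in> {1..r} \<Longrightarrow> even (int \<alpha> + j + \<kappa> \<alpha> j)"
    and kappa_step_row: "\<And>\<alpha> j. \<alpha> \<in> {1..<r} \<Longrightarrow> \<bar>\<kappa> (\<alpha> + 1) j - \<kappa> \<alpha> j\<bar> = 1"
    and kappa_step_col: "\<And>\<alpha> j. \<alpha> \<in> {1..r} \<Longrightarrow> \<bar>\<kappa> \<alpha> (j + 1) - \<kappa> \<alpha> j\<bar> = 1"
    and B: "\<And>\<alpha> j. \<alpha> \<in> {1..r} \<Longrightarrow> \<bar>\<kappa> \<alpha> j\<bar> \<le> B"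
    and sys: "T_system r T"
    and bdry: "\<And>\<alpha> j. \<alpha> \<in> {1..r} \<Longrightarrow> subtraction_free (T \<alpha> j (\<kappa> \<alpha> j))"
begin

lemma T_boundary_rows: "\<alpha> = 0 \<or> \<alpha> = r + 1 \<Longrightarrow> even (int \<alpha> + j + k) \<Longrightarrow> T \<alpha> j k = 1"
  using sys unfolding T_system_def by blast

lemma T_relation:
  "\<alpha> \<in> {1..r} \<Longrightarrow> odd (int \<alpha> + j + k) \<Longrightarrow>
   T \<alpha> j (k + 1) * T \<alpha> j (k - 1) =
     T \<alpha> (j + 1) k * T \<alpha> (j - 1) k + T (\<alpha> + 1) j k * T (\<alpha> - 1) j k"
  using sys unfolding T_system_def by blast

text \<open>The relation centred one step below \<open>(\<alpha>, j, k)\<close> is solved for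
  \<open>T \<alpha> j k\<close>. The other values have smaller third coordinate and, as the boundary
  changes by one between neighbours, still lie on or above it, or they are 1 in the rows 0 and
  \<open>r + 1\<close>.\<close>

lemma T_subtraction_free_above:
  assumes "\<alpha> \<in> {1..r}" "even (int \<alpha> + j + k)" "\<kappa> \<alpha> j \<le> k"
  shows "subtraction_free (T \<alpha> j k)"
proof -
  have "\<forall>\<alpha> j k. \<alpha> \<in> {1..r} \<longrightarrow> even (int \<alpha> + j + k) \<longrightarrow> \<kappa> \<alpha> j \<le> k \<longrightarrow> nat (k + B) = n
    \<longrightarrow> subtraction_free (T \<alpha> j k)" for n
  proof (induction n rule: less_induct)
    case (less n)
    show ?case
    proof (intro allI impI)
      fix \<alpha> j k assume \<alpha>: "\<alpha> \<in> {1..r}" and ev: "even (int \<alpha> + j + k)" and ge: "\<kappa> \<alpha> j \<le> k"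
        and n: "nat (k + B) = n"
      show "subtraction_free (T \<alpha> j k)"
      proof (cases "k = \<kappa> \<alpha> j")
        case True
        then show ?thesis using bdry[OF \<alpha>] by simp
      next
        case False
        \<comment> \<open>Parity leaves a gap of two above the boundary, which absorbs its unit
          change towards the neighbours.\<close>
        have "k \<noteq> \<kappa> \<alpha> j + 1" using ev kappa_parity[OF \<alpha>, of j] by auto
        with False ge have k2: "\<kappa> \<alpha> j + 2 \<le> k" by linarith
        have IH: "subtraction_free (T \<alpha>' j' k')"
          if "\<alpha>' \<in> {1..r}" "even (int \<alpha>' + j' + k')" "\<kappa> \<alpha>' j' \<le> k'" "k' < k" for \<alpha>' j' k'
        proof -
          \<comment> \<open>\<open>k'\<close> is at least \<open>- B\<close>, so \<open>nat\<close>
            truncates nothing and the measure drops strictly.\<close>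
          have "nat (k' + B) < n" using n that B[OF that(1), of j'] by linarith
          then show ?thesis using less.IH that by blast
        qed
        have nb: "subtraction_free (T \<alpha>' j (k - 1))"
          if "\<alpha>' = \<alpha> + 1 \<or> \<alpha>' = \<alpha> - 1" for \<alpha>'
        proof -
          have ev': "even (int \<alpha>' + j + (k - 1))" using that ev \<alpha> by auto
          show ?thesis
          proof (cases "\<alpha>' = 0 \<or> \<alpha>' = r + 1")
            case True
            then show ?thesis using T_boundary_rows ev' subtraction_free_one by metis
          next
            case False
            then have \<alpha>': "\<alpha>' \<in> {1..r}" using that \<alpha> by auto
            have "\<bar>\<kappa> \<alpha>' j - \<kappa> \<alpha> j\<bar> = 1"
              using that \<alpha>' \<alpha> kappa_step_row[of \<alpha> j] kappa_step_row[of "\<alpha> - 1" j]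
              by (auto simp: abs_minus_commute)
            then show ?thesis using k2 by (intro IH[OF \<alpha>' ev']) auto
          qed
        qed
        have hz: "subtraction_free (T \<alpha> j' (k - 1))" if "j' = j + 1 \<or> j' = j - 1" for j'
        proof (rule IH[OF \<alpha>])
          show "even (int \<alpha> + j' + (k - 1))" using that ev by auto
          show "\<kappa> \<alpha> j' \<le> k - 1"
            using that kappa_step_col[OF \<alpha>, of j] kappa_step_col[OF \<alpha>, of "j - 1"] k2 by auto
        qed simp
        have "odd (int \<alpha> + j + (k - 1))" using ev by simp
        from T_relation[OF \<alpha> this]
        have rel: "T \<alpha> j k * T \<alpha> j (k - 2) = T \<alpha> (j + 1) (k - 1) * T \<alpha> (j - 1) (k - 1) +
            T (\<alpha> + 1) j (k - 1) * T (\<alpha> - 1) j (k - 1)"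
          by (simp add: algebra_simps)
        show ?thesis
        proof (rule subtraction_free_other_factor[OF rel])
          show "subtraction_free (T \<alpha> j (k - 2))"
            using ev k2 by (intro IH[OF \<alpha>]) auto
        qed (intro subtraction_free_add subtraction_free_mult hz nb; simp)
      qed
    qed
  qed
  then show ?thesis using assms by blast
qed

end

text \<open>The relation is symmetric in \<open>k + 1\<close> and \<open>k - 1\<close>. Points below
  \<open>\<kappa>\<close> become points above \<open>- \<kappa>\<close>, so positivity need be
  propagated in one direction only.\<close>

lemma T_system_reflect:
  assumes "T_system r T"
  shows "T_system r (\<lambda>\<alpha> j k. T \<alpha> j (- k))"
  unfolding T_system_def
proof (intro conjI ballI allI impI)
  fix \<alpha> j k assume "\<alpha> \<in> {0, r + 1}" "even (int \<alpha> + j + k)"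
  then show "T \<alpha> j (- k) = 1"
    using assms unfolding T_system_def by (metis even_add even_minus)
next
  fix \<alpha> j k assume \<alpha>: "\<alpha> \<in> {1..r}" "odd (int \<alpha> + j + k)"
  then have "odd (int \<alpha> + j + - k)" by simp
  then have "T \<alpha> j (- k + 1) * T \<alpha> j (- k - 1) =
      T \<alpha> (j + 1) (- k) * T \<alpha> (j - 1) (- k) + T (\<alpha> + 1) j (- k) * T (\<alpha> - 1) j (- k)"
    using assms \<alpha>(1) unfolding T_system_def by blast
  moreover have "- (k + 1) = - k - 1" "- (k - 1) = - k + 1" by simp_all
  ultimately show "T \<alpha> j (- (k + 1)) * T \<alpha> j (- (k - 1)) =
      T \<alpha> (j + 1) (- k) * T \<alpha> (j - 1) (- k) + T (\<alpha> + 1) j (- k) * T (\<alpha> - 1) j (- k)"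
    by (simp only: mult.commute)
qed

lemma T_nonzero:
  fixes T :: "nat \<Rightarrow> int \<Rightarrow> int \<Rightarrow> 'c::field_char_0 ratfun"
  assumes adm: "admissible_boundary r \<kappa>" and sys: "T_system r T"
    and bdry: "\<forall>\<beta>\<in>{1..r}. \<forall>i. T \<beta> i (\<kappa> \<beta> i) = indet \<beta> i"
    and \<alpha>: "\<alpha> \<le> r + 1" "even (int \<alpha> + j + k)"
  shows "T \<alpha> j k \<noteq> 0"
proof (cases "\<alpha> = 0 \<or> \<alpha> = r + 1")
  case True
  then show ?thesis using sys \<alpha> unfolding T_system_def by (metis insertCI zero_neq_one)
next
  case False
  then have \<alpha>r: "\<alpha> \<in> {1..r}" using \<alpha>(1) by auto
  obtain B where B: "\<And>\<alpha> j. \<alpha> \<in> {1..r} \<Longrightarrow> \<bar>\<kappa> \<alpha> j\<bar> \<le> B"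
    using admissible_boundary_bounded[OF adm] by blast
  have par: "\<And>\<alpha> j. \<alpha> \<in> {1..r} \<Longrightarrow> even (int \<alpha> + j + \<kappa> \<alpha> j)"
    and row: "\<And>\<alpha> j. \<alpha> \<in> {1..<r} \<Longrightarrow> \<bar>\<kappa> (\<alpha> + 1) j - \<kappa> \<alpha> j\<bar> = 1"
    and col: "\<And>\<alpha> j. \<alpha> \<in> {1..r} \<Longrightarrow> \<bar>\<kappa> \<alpha> (j + 1) - \<kappa> \<alpha> j\<bar> = 1"
    using adm unfolding admissible_boundary_def by blast+
  have sf: "\<And>\<alpha> j. \<alpha> \<in> {1..r} \<Longrightarrow> subtraction_free (T \<alpha> j (\<kappa> \<alpha> j))"
    using bdry subtraction_free_indet by metis
  have "subtraction_free (T \<alpha> j k)"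
  proof (cases "\<kappa> \<alpha> j \<le> k")
    case True
    then show ?thesis
      using T_subtraction_free_above[where \<kappa> = \<kappa> and r = r and T = T and B = B,
          OF par row col B sys sf \<alpha>r \<alpha>(2)] by blast
  next
    case False
    have "subtraction_free (T \<alpha> j (- (- k)))"
    proof (rule T_subtraction_free_above[where \<kappa> = "\<lambda>\<alpha> j. - \<kappa> \<alpha> j" and r = r and B = B
          and T = "\<lambda>\<alpha> j k. T \<alpha> j (- k)"])
      fix \<beta> i
      show "\<beta> \<in> {1..<r} \<Longrightarrow> \<bar>- \<kappa> (\<beta> + 1) i - - \<kappa> \<beta> i\<bar> = 1"
        using row[of \<beta> i] by (simp add: abs_minus_commute)
      show "\<beta> \<in> {1..r} \<Longrightarrow> \<bar>- \<kappa> \<beta> (i + 1) - - \<kappa> \<beta> i\<bar> = 1"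
        using col[of \<beta> i] by (simp add: abs_minus_commute)
    qed (use par B sf \<alpha>r \<alpha>(2) False T_system_reflect[OF sys] in \<open>auto simp: even_minus\<close>)
    then show ?thesis by simp
  qed
  then show ?thesis by (rule subtraction_free_nonzero)
qed


section \<open>Products of matrices acting on vectors\<close>

definition mat_app :: "nat \<Rightarrow> 'f::field matrix \<Rightarrow> (nat \<Rightarrow> 'f) \<Rightarrow> nat \<Rightarrow> 'f" where
  "mat_app r E v x = (\<Sum>y\<in>{1..r + 1}. E x y * v y)"

text \<open>The head of the list acts last, like the leftmost factor of a product applied to a
  column vector.\<close>

definition mat_apps :: "nat \<Rightarrow> 'f::field matrix list \<Rightarrow> (nat \<Rightarrow> 'f) \<Rightarrow> nat \<Rightarrow> 'f" where
  "mat_apps r Es = foldr (mat_app r) Es"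

lemma mat_apps_simps [simp]:
  "mat_apps r [] v = v"
  "mat_apps r (E # Es) v = mat_app r E (mat_apps r Es v)"
  "mat_apps r (Es @ Es') v = mat_apps r Es (mat_apps r Es' v)"
  by (simp_all add: mat_apps_def)

lemma mat_app_cong:
  assumes "\<And>y. y \<in> {1..r + 1} \<Longrightarrow> v y = w y"
  shows "mat_app r E v x = mat_app r E w x"
  unfolding mat_app_def using assms by (intro sum.cong) auto

lemma mat_apps_cong:
  assumes "\<And>y. y \<in> {1..r + 1} \<Longrightarrow> v y = w y" "x \<in> {1..r + 1}"
  shows "mat_apps r Es v x = mat_apps r Es w x"
  using assms(2)
proof (induction Es arbitrary: x)
  case Nil
  then show ?case using assms(1) by simp
next
  case (Cons E Es)
  show ?case unfolding mat_apps_simps by (rule mat_app_cong) (rule Cons.IH)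
qed

lemma mat_apps_scale: "mat_apps r Es (\<lambda>y. v y * c) x = mat_apps r Es v x * c"
proof (induction Es arbitrary: x)
  case (Cons E Es)
  then have "mat_apps r Es (\<lambda>y. v y * c) = (\<lambda>x. mat_apps r Es v x * c)" by blast
  then show ?case
    by (simp only: mat_apps_simps mat_app_def sum_distrib_right mult.assoc)
qed simp

definition unit_state :: "nat \<Rightarrow> nat \<Rightarrow> 'f::field" where
  "unit_state y x = (if x = y then 1 else 0)"


section \<open>Recursions for sums over families of disjoint paths\<close>

definition families_sum ::
    "nat \<Rightarrow> 'f::field matrix list \<Rightarrow> nat \<Rightarrow> (nat \<times> nat) set \<Rightarrow> (nat \<times> nat) set \<Rightarrow> 'f" where
  "families_sum r Es n A B = (\<Sum>F\<in>disjoint_path_families (network r Es) n A B. family_weight Es F)"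

lemma arcs_ends_network:
  "arcs_ends (network r Es) = {((l, x), (l + 1, y)) | l x y.
     l < length Es \<and> x \<in> {1..r + 1} \<and> y \<in> {1..r + 1} \<and> (Es ! l) x y \<noteq> 0}"
  by (simp add: arcs_ends_def arc_to_ends_def network_def)

lemma network_walk_layers:
  assumes "vwalk p (network r Es)" "v \<in> set p"
  shows "v = hd p \<or> fst (hd p) < fst v"
  using assms
proof (induction p rule: list.induct)
  case (Cons u p)
  show ?case
  proof (cases "p = []")
    case False
    with Cons.prems(1) have "(u, hd p) \<in> arcs_ends (network r Es)" "vwalk p (network r Es)"
      by (auto elim: vwalk_consE)
    then show ?thesis
      using Cons.IH Cons.prems(2) by (force simp: arcs_ends_network)
  qed (use Cons.prems in auto)
qed simp

lemma finite_disjoint_path_families: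
  assumes "finite (verts G)"
  shows "finite (disjoint_path_families G n A B)"
proof (rule finite_subset)
  show "disjoint_path_families G n A B \<subseteq> Pow {p. set p \<subseteq> verts G \<and> distinct p}"
    by (auto simp: disjoint_path_families_def vpath_def vwalk_def)
  show "finite (Pow {p. set p \<subseteq> verts G \<and> distinct p})"
    using finite_subset_distinct[OF assms] by simp
qed

lemma finite_verts_network: "finite (verts (network r Es))"
  by (simp add: network_def)

lemma disjoint_path_families_insert_iff:
  assumes "p \<notin> R"
  shows "insert p R \<in> disjoint_path_families G n A B \<longleftrightarrow>
    finite R \<and> Suc (card R) = n \<and> vpath p G \<and> (\<forall>q\<in>R. vpath q G) \<and>
    (\<forall>q\<in>R. disjnt (set p) (set q)) \<and> pairwise (\<lambda>p q. disjnt (set p) (set q)) R \<and>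
    insert (hd p) (hd ` R) = A \<and> insert (last p) (last ` R) = B"
  using assms unfolding disjoint_path_families_def
  by (auto simp: pairwise_insert disjnt_sym)

text \<open>Disjointness makes \<open>hd\<close> and \<open>last\<close> injective on a family, so
  removing one path deletes exactly one start and one end.\<close>

lemma disjoint_path_families_split:
  assumes F: "F \<in> disjoint_path_families G n A B" and "a \<in> A"
  obtains p R where "F = insert p R" "p \<notin> R" "hd p = a" "hd ` R = A - {a}"
    "last ` R = B - {last p}" "last p \<in> B"
proof -
  obtain p where p: "p \<in> F" "hd p = a"
    using assms by (auto simp: disjoint_path_families_def)
  have ne: "q \<noteq> []" if "q \<in> F" for q
    using F that by (auto simp: disjoint_path_families_def vpath_def vwalk_def)
  have dis: "disjnt (set p) (set q)" if "q \<in> F - {p}" for q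
    using F p that by (auto simp: disjoint_path_families_def pairwise_def)
  have hl: "hd q \<noteq> a" "last q \<noteq> last p" if "q \<in> F - {p}" for q
    using dis[OF that] ne[of p] ne[of q] that p
    by (metis DiffD1 disjnt_iff hd_in_set, metis DiffD1 disjnt_iff last_in_set)
  have A: "A = hd ` F" and B: "B = last ` F"
    using F by (auto simp: disjoint_path_families_def)
  have "hd ` (F - {p}) = A - {a}"
    unfolding A using hl(1) p(2) by fastforce
  moreover have "last ` (F - {p}) = B - {last p}"
    unfolding B using hl(2) by fastforce
  moreover have "last p \<in> B" using p(1) B by simp
  moreover have "F = insert p (F - {p})" using p(1) by blast
  ultimately show ?thesis
    using that[of p "F - {p}"] p(2) by blast
qed

lemma family_weight_insert:
  assumes "finite R" "p \<notin> R"
  shows "family_weight Es (insert p R) =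
    (\<Prod>e\<leftarrow>vwalk_arcs p. edge_weight Es e) * family_weight Es R"
  using assms by (simp add: family_weight_def)

lemma families_sum_empty: "families_sum r Es 0 {} {} = 1"
proof -
  have "disjoint_path_families (network r Es) 0 {} {} = {{}}"
    by (auto simp: disjoint_path_families_def)
  then show ?thesis by (simp add: families_sum_def family_weight_def)
qed

lemma families_sum_unreachable:
  assumes "e \<in> B" "e \<notin> A" "\<And>v. v \<in> A \<Longrightarrow> fst e \<le> fst v"
  shows "families_sum r Es n A B = 0"
proof -
  have "F \<notin> disjoint_path_families (network r Es) n A B" for F
  proof
    assume F: "F \<in> disjoint_path_families (network r Es) n A B"
    then obtain p where p: "p \<in> F" "last p = e" "hd p \<in> A"
      using assms(1) by (auto simp: disjoint_path_families_def)
    have "vwalk p (network r Es)"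
      using F p(1) by (auto simp: disjoint_path_families_def vpath_def)
    then have "e = hd p \<or> fst (hd p) < fst e"
      using network_walk_layers p(2) by (metis vwalk_def last_in_set)
    then show False
      using assms(2) assms(3)[OF p(3)] p(3) by auto
  qed
  then have "disjoint_path_families (network r Es) n A B = {}" by blast
  then show ?thesis by (simp add: families_sum_def)
qed

text \<open>The path from \<open>v\<close> must be \<open>[v]\<close>: otherwise a second path would
  end in \<open>v\<close>, which the first one contains. Conversely no path from another start
  passes through \<open>v\<close>, since layers grow along paths, so \<open>[v]\<close> can always
  be added.\<close>

lemma families_sum_end:
  assumes v: "v \<in> A" "v \<in> B" "v \<in> verts (network r Es)"
    and min: "\<And>w. w \<in> A \<Longrightarrow> fst v \<le> fst w"
  shows "families_sum r Es (Suc n) A B = families_sum r Es n (A - {v}) (B - {v})"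
  unfolding families_sum_def
proof (rule sum.reindex_bij_witness[where j = "\<lambda>F. F - {[v]}" and i = "insert [v]"])
  let ?G = "network r Es"
  fix F assume F: "F \<in> disjoint_path_families ?G (Suc n) A B"
  then obtain p R where pR: "F = insert p R" "p \<notin> R" "hd p = v" "hd ` R = A - {v}"
      "last ` R = B - {last p}" "last p \<in> B"
    using disjoint_path_families_split[OF F v(1)] by metis
  note ins = F[unfolded pR(1) disjoint_path_families_insert_iff[OF pR(2)]]
  have pne: "p \<noteq> []" using ins by (auto simp: vpath_def vwalk_def)
  have "last p = v"
  proof (rule ccontr)
    assume "last p \<noteq> v"
    then have "v \<in> last ` R" using pR(5) v(2) by simp
    then obtain q where q: "q \<in> R" "last q = v" by blast
    then have "q \<noteq> []" using ins by (auto simp: vpath_def vwalk_def)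
    then have "v \<in> set q" "v \<in> set p" using q(2) pR(3) pne by (metis hd_in_set last_in_set)+
    moreover have "disjnt (set p) (set q)" using ins q(1) by blast
    ultimately show False by (meson disjnt_iff)
  qed
  moreover have "distinct p" using ins by (simp add: vpath_def)
  ultimately have p: "p = [v]"
    using pR(3) pne by (metis distinct.simps(2) last_ConsR last_in_set list.collapse)
  have R: "F - {[v]} = R" using pR(1,2) p by simp
  show "insert [v] (F - {[v]}) = F" unfolding R using pR(1) p by simp
  show "F - {[v]} \<in> disjoint_path_families ?G n (A - {v}) (B - {v})"
    unfolding R using ins pR(4,5) p by (auto simp: disjoint_path_families_def)
  show "family_weight Es (F - {[v]}) = family_weight Es F"
    unfolding R unfolding pR(1) using ins pR(2) p by (simp add: family_weight_insert)
next
  let ?G = "network r Es"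
  fix R assume R: "R \<in> disjoint_path_families ?G n (A - {v}) (B - {v})"
  have notin: "v \<notin> set q" if "q \<in> R" for q
  proof
    assume vq: "v \<in> set q"
    have "vwalk q ?G" "hd q \<in> A - {v}"
      using R that by (auto simp: disjoint_path_families_def vpath_def)
    with network_walk_layers[OF this(1) vq] min show False by fastforce
  qed
  then have nR: "[v] \<notin> R" by force
  then show "insert [v] R - {[v]} = R" by blast
  have "vpath [v] ?G" using v(3) by (simp add: vpath_def vwalk_def)
  then show "insert [v] R \<in> disjoint_path_families ?G (Suc n) A B"
    unfolding disjoint_path_families_insert_iff[OF nR]
    using R notin v by (auto simp: disjoint_path_families_def)
qed

text \<open>Deleting \<open>(l, x)\<close> from the front of its path is a bijection, with the
  height \<open>y\<close> of the second vertex as extra datum. Minimality of \<open>l\<close>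
  ensures that \<open>(l, x)\<close> can be put back without meeting another path. If
  \<open>(l + 1, y)\<close> is itself a start, two paths would share it, whence the 0.\<close>

lemma families_sum_step:
  assumes v: "(l, x) \<in> A" "(l, x) \<notin> B" "l < length Es" "x \<in> {1..r + 1}"
    and min: "\<And>w. w \<in> A \<Longrightarrow> l \<le> fst w"
  shows "families_sum r Es n A B = (\<Sum>y\<in>{1..r + 1}. (Es ! l) x y *
    (if (l + 1, y) \<in> A then 0 else families_sum r Es n (insert (l + 1, y) (A - {(l, x)})) B))"
proof -
  let ?G = "network r Es" and ?v = "(l, x)"
  let ?D = "\<lambda>y. disjoint_path_families ?G n (insert (l + 1, y) (A - {?v})) B"
  define Y where "Y = {y \<in> {1..r + 1}. (Es ! l) x y \<noteq> 0 \<and> (l + 1, y) \<notin> A}"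
  have finY: "finite Y" by (simp add: Y_def)
  define shrink where
    "shrink F = (snd (hd (tl (THE p. p \<in> F \<and> hd p = ?v))), (\<lambda>p. if hd p = ?v then tl p else p) ` F)"
    for F :: "(nat \<times> nat) list set"
  define extend where
    "extend = (\<lambda>(y, F). (\<lambda>p. if hd p = (l + 1, y) then ?v # p else p) ` F)"
  have "families_sum r Es n A B =
      (\<Sum>(y, F)\<in>Sigma Y ?D. (Es ! l) x y * family_weight Es F)"
    unfolding families_sum_def
  proof (rule sum.reindex_bij_witness[where j = shrink and i = extend])
    fix F assume F: "F \<in> disjoint_path_families ?G n A B"
    then obtain p R where pR: "F = insert p R" "p \<notin> R" "hd p = ?v" "hd ` R = A - {?v}"
        "last ` R = B - {last p}" "last p \<in> B"
      using disjoint_path_families_split[OF F v(1)] by metis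
    note ins = F[unfolded pR(1) disjoint_path_families_insert_iff[OF pR(2)]]
    have pne: "p \<noteq> []" using ins by (auto simp: vpath_def vwalk_def)
    define q where "q = tl p"
    have p: "p = ?v # q" using pR(3) pne q_def by (metis list.collapse)
    have qne: "q \<noteq> []" using pR(6) v(2) p by auto
    have "vwalk (?v # q) ?G" "distinct (?v # q)" using ins p by (auto simp: vpath_def)
    then have vq: "vpath q ?G" and "(?v, hd q) \<in> arcs_ends ?G"
      using qne by (auto elim!: vwalk_consE simp: vpath_def)
    then obtain y where y: "hd q = (l + 1, y)" "y \<in> {1..r + 1}" "(Es ! l) x y \<noteq> 0"
      by (auto simp: arcs_ends_network)
    have hdq: "hd q \<in> set p" using hd_in_set[OF qne] p by simp
    have Rv: "hd p' \<noteq> ?v \<and> hd p' \<noteq> (l + 1, y)" if "p' \<in> R" for p'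
    proof -
      have "p' \<noteq> []" "disjnt (set p) (set p')" using ins that by (auto simp: vpath_def vwalk_def)
      then have "hd p' \<notin> set p" by (metis disjnt_iff hd_in_set)
      then show ?thesis using hdq y(1) p by auto
    qed
    have yA: "(l + 1, y) \<notin> A"
    proof
      assume "(l + 1, y) \<in> A"
      then have "(l + 1, y) \<in> hd ` R" using pR(4) by auto
      then show False using Rv by force
    qed
    have qR: "q \<notin> R" using Rv y(1) by blast
    have the: "(THE p. p \<in> F \<and> hd p = ?v) = p"
      using pR Rv by (intro the_equality) auto
    have im: "(\<lambda>p. if hd p = ?v then tl p else p) ` F = insert q R"
      using Rv unfolding pR(1) p by force
    have sh: "shrink F = (y, insert q R)"
      unfolding shrink_def the im using y(1) q_def by simp
    show "extend (shrink F) = F"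
      unfolding sh extend_def using Rv y(1) p pR(1) by force
    have "set q \<subseteq> set p" using p by auto
    then have "\<forall>p'\<in>R. disjnt (set q) (set p')"
      using ins disjnt_subset1 by blast
    then have "insert q R \<in> ?D y"
      unfolding disjoint_path_families_insert_iff[OF qR]
      using ins vq y(1) pR(4) p qne by auto
    then show "shrink F \<in> Sigma Y ?D"
      unfolding sh Y_def using y yA by simp
    have "family_weight Es F = (Es ! l) x y * family_weight Es (insert q R)"
      unfolding pR(1) using ins pR(2) qR p qne y(1)
      by (simp add: family_weight_insert edge_weight_def mult.assoc)
    then show "(case shrink F of (y, F) \<Rightarrow> (Es ! l) x y * family_weight Es F) = family_weight Es F"
      by (simp add: sh)
  next
    fix yF assume "yF \<in> Sigma Y ?D"
    then obtain y F where yF: "yF = (y, F)" and y: "y \<in> Y" and F: "F \<in> ?D y" by blast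
    have yA: "(l + 1, y) \<notin> A" using y by (simp add: Y_def)
    obtain q R where pR: "F = insert q R" "q \<notin> R" "hd q = (l + 1, y)"
        "hd ` R = insert (l + 1, y) (A - {?v}) - {(l + 1, y)}"
      using disjoint_path_families_split[OF F insertI1] by metis
    have hdR: "hd ` R = A - {?v}" using pR(4) yA by auto
    note ins = F[unfolded pR(1) disjoint_path_families_insert_iff[OF pR(2)]]
    have qne: "q \<noteq> []" using ins by (auto simp: vpath_def vwalk_def)
    have Rv: "?v \<notin> set p' \<and> hd p' \<noteq> ?v \<and> hd p' \<noteq> (l + 1, y)" if p': "p' \<in> R" for p'
    proof -
      have "vwalk p' ?G" using ins p' by (auto simp: vpath_def)
      moreover have "hd p' \<in> A - {?v}" using hdR p' by blast
      ultimately show ?thesis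
        using network_walk_layers[of p' r Es ?v] min[of "hd p'"] yA by fastforce
    qed
    have vq: "?v \<notin> set q"
      using network_walk_layers[of q r Es ?v] ins pR(3) by (auto simp: vpath_def)
    have arc: "(?v, hd q) \<in> arcs_ends ?G"
      using y v pR(3) by (auto simp: Y_def arcs_ends_network)
    have vv: "?v \<in> verts ?G" using v by (simp add: network_def)
    have vp: "vpath (?v # q) ?G"
      using ins vq arc vv by (auto simp: vpath_def intro: vwalk_consI)
    have ex: "extend yF = insert (?v # q) R"
      unfolding yF extend_def pR(1) using Rv pR(3) by force
    have nR: "?v # q \<notin> R" using Rv by force
    show "extend yF \<in> disjoint_path_families ?G n A B"
      unfolding ex disjoint_path_families_insert_iff[OF nR]
      using ins vp hdR Rv v(1) qne by (auto simp: disjnt_iff)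
    have the: "(THE p. p \<in> extend yF \<and> hd p = ?v) = ?v # q"
      unfolding ex using Rv by (intro the_equality) auto
    have im: "(\<lambda>p. if hd p = ?v then tl p else p) ` extend yF = insert q R"
      unfolding ex using Rv by force
    show "shrink (extend yF) = yF"
      unfolding shrink_def the im using pR(1,3) yF by simp
  qed
  also have "\<dots> = (\<Sum>y\<in>Y. (Es ! l) x y * families_sum r Es n (insert (l + 1, y) (A - {?v})) B)"
    unfolding families_sum_def sum_distrib_left
    by (subst sum.Sigma[OF finY])
      (use finite_disjoint_path_families[OF finite_verts_network] in auto)
  also have "\<dots> = (\<Sum>y\<in>{1..r + 1}. (Es ! l) x y *
      (if (l + 1, y) \<in> A then 0 else families_sum r Es n (insert (l + 1, y) (A - {?v})) B))"
    by (rule sum.mono_neutral_cong_left) (auto simp: Y_def)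
  finally show ?thesis .
qed


section \<open>The determinant formula for path families\<close>

text \<open>An entry of the product of the factors between two layers. The zero branch matters: for
  a backward pair the list of factors is empty and would yield an entry of the identity.\<close>

definition path_sum :: "nat \<Rightarrow> 'f::field matrix list \<Rightarrow> nat \<times> nat \<Rightarrow> nat \<times> nat \<Rightarrow> 'f" where
  "path_sum r Es v e = (if fst v \<le> fst e
     then mat_apps r (drop (fst v) (take (fst e) Es)) (unit_state (snd e)) (snd v) else 0)"

definition path_det ::
    "nat \<Rightarrow> 'f::field matrix list \<Rightarrow> (nat \<times> nat) list \<Rightarrow> (nat \<times> nat) list \<Rightarrow> 'f" where
  "path_det r Es vs es =
     det (mat (length es) (length es) (\<lambda>(i, j). path_sum r Es (vs ! i) (es ! j)))"

text \<open>
  The recursion below may let two starting vertices collide, hence the convention that such a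
  list of starting vertices has no families.
\<close>

definition det_formula ::
    "nat \<Rightarrow> 'f::field matrix list \<Rightarrow> (nat \<times> nat) list \<Rightarrow> (nat \<times> nat) list \<Rightarrow> bool" where
  "det_formula r Es vs es \<longleftrightarrow>
     (if distinct vs then families_sum r Es (length es) (set vs) (set es) else 0) = path_det r Es vs es"

lemma path_sum_step:
  assumes "l < length Es" "fst e \<le> length Es" "(l, x) \<noteq> e"
  shows "path_sum r Es (l, x) e = (\<Sum>y\<in>{1..r + 1}. (Es ! l) x y * path_sum r Es (l + 1, y) e)"
proof (cases "l < fst e")
  case True
  have "drop l (take (fst e) Es) = Es ! l # drop (l + 1) (take (fst e) Es)"
    using True assms by (subst Cons_nth_drop_Suc[symmetric]) auto
  then show ?thesis
    using True by (simp only: path_sum_def mat_apps_simps mat_app_def fst_conv snd_conv) simp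
next
  case False
  then have "path_sum r Es (l, x) e = 0"
    using assms(3) by (cases e) (auto simp: path_sum_def unit_state_def)
  moreover have "path_sum r Es (l + 1, y) e = 0" for y
    using False by (simp add: path_sum_def)
  ultimately show ?thesis by simp
qed

text \<open>Only row \<open>\<rho>\<close> depends on the moved vertex, so the cofactors along it
  stay the same and the determinant inherits the recursion of its entries.\<close>

lemma path_det_step:
  assumes "l < length Es" "\<And>e. e \<in> set es \<Longrightarrow> fst e \<le> length Es \<and> e \<noteq> (l, x)"
    and \<rho>: "\<rho> < length es" "length vs = length es" "vs ! \<rho> = (l, x)"
  shows "path_det r Es vs es =
    (\<Sum>y\<in>{1..r + 1}. (Es ! l) x y * path_det r Es (vs[\<rho> := (l + 1, y)]) es)"
proof -
  let ?n = "length es"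
  let ?A = "\<lambda>vs. mat ?n ?n (\<lambda>(i, j). path_sum r Es (vs ! i) (es ! j))"
  let ?vs = "\<lambda>y. vs[\<rho> := (l + 1, y)]"
  have cof: "cofactor (?A (?vs y)) \<rho> j = cofactor (?A vs) \<rho> j" if "j < ?n" for y j
  proof -
    have "mat_delete (?A (?vs y)) \<rho> j = mat_delete (?A vs) \<rho> j"
      using \<rho> that by (intro eq_matI) (auto simp: mat_delete_def nth_list_update)
    then show ?thesis by (simp add: cofactor_def)
  qed
  have exp: "path_det r Es ws es =
      (\<Sum>j<?n. path_sum r Es (ws ! \<rho>) (es ! j) * cofactor (?A ws) \<rho> j)" for ws
    unfolding path_det_def by (subst laplace_expansion_row[of _ ?n \<rho>]) (use \<rho> in auto)
  have "path_sum r Es (l, x) (es ! j) =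
      (\<Sum>y\<in>{1..r + 1}. (Es ! l) x y * path_sum r Es (l + 1, y) (es ! j))" if "j < ?n" for j
    using assms(2)[OF nth_mem[OF that]] by (intro path_sum_step[OF assms(1)]) auto
  then have "path_det r Es vs es = (\<Sum>j<?n. (\<Sum>y\<in>{1..r + 1}. (Es ! l) x y *
      path_sum r Es (l + 1, y) (es ! j)) * cofactor (?A vs) \<rho> j)"
    unfolding exp \<rho>(3) by (intro sum.cong refl arg_cong2[where f = "(*)"]) simp
  also have "\<dots> = (\<Sum>y\<in>{1..r + 1}. \<Sum>j<?n. (Es ! l) x y *
      (path_sum r Es (l + 1, y) (es ! j) * cofactor (?A vs) \<rho> j))"
    unfolding sum_distrib_right by (subst sum.swap) (simp only: mult.assoc)
  also have "\<dots> = (\<Sum>y\<in>{1..r + 1}. (Es ! l) x y * path_det r Es (?vs y) es)"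
    unfolding exp sum_distrib_left
    by (intro sum.cong refl) (use \<rho> cof in auto)
  finally show ?thesis .
qed

lemma det_formula_not_distinct:
  assumes "\<not> distinct vs" "length vs = length es"
  shows "det_formula r Es vs es"
proof -
  obtain i j where ij: "i < length es" "j < length es" "i \<noteq> j" "vs ! i = vs ! j"
    using assms by (auto simp: distinct_conv_nth)
  let ?A = "mat (length es) (length es) (\<lambda>(i, j). path_sum r Es (vs ! i) (es ! j))"
  have "det ?A = 0"
  proof (rule det_identical_rows)
    show "?A \<in> carrier_mat (length es) (length es)" by simp
    show "row ?A i = row ?A j" using ij by (intro eq_vecI) auto
  qed (use ij in auto)
  then show ?thesis using assms by (simp add: det_formula_def path_det_def)
qed

text \<open>A move onto another start contributes 0 on both sides, by convention on one and by equal
  rows on the other. Demanding \<open>step\<close> for nonzero entries only is what later confines a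
  path to neighbouring heights.\<close>

lemma det_formula_step:
  assumes l: "l < length Es" and es: "\<And>e. e \<in> set es \<Longrightarrow> fst e \<le> length Es \<and> e \<noteq> (l, x)"
    and \<rho>: "\<rho> < length es" "length vs = length es" "vs ! \<rho> = (l, x)"
    and x: "x \<in> {1..r + 1}" and min: "\<And>w. w \<in> set vs \<Longrightarrow> l \<le> fst w"
    and step: "\<And>y. y \<in> {1..r + 1} \<Longrightarrow> (Es ! l) x y \<noteq> 0 \<Longrightarrow>
      det_formula r Es (vs[\<rho> := (l + 1, y)]) es"
  shows "det_formula r Es vs es"
proof (cases "distinct vs")
  case False
  then show ?thesis using det_formula_not_distinct \<rho>(2) by blast
next
  case True
  let ?vs = "\<lambda>y. vs[\<rho> := (l + 1, y)]"
  have set: "set (?vs y) = insert (l + 1, y) (set vs - {(l, x)})" for y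
    using set_update_distinct[OF True] \<rho> by simp
  have dist: "distinct (?vs y) \<longleftrightarrow> (l + 1, y) \<notin> set vs" for y
  proof
    assume "(l + 1, y) \<notin> set vs"
    then show "distinct (?vs y)" using True by (intro distinct_list_update) auto
  next
    assume d: "distinct (?vs y)"
    show "(l + 1, y) \<notin> set vs"
    proof
      assume "(l + 1, y) \<in> set vs"
      then obtain i where i: "i < length vs" "vs ! i = (l + 1, y)" by (auto simp: in_set_conv_nth)
      then have "i \<noteq> \<rho>" using \<rho>(3) by auto
      moreover have "?vs y ! i = ?vs y ! \<rho>"
        using i \<rho> calculation by simp
      ultimately show False
        using d i \<rho> by (simp add: nth_eq_iff_index_eq del: nth_list_update_neq nth_list_update_eq)
    qed
  qed
  have "families_sum r Es (length es) (set vs) (set es) = (\<Sum>y\<in>{1..r + 1}. (Es ! l) x y *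
      (if (l + 1, y) \<in> set vs then 0
       else families_sum r Es (length es) (insert (l + 1, y) (set vs - {(l, x)})) (set es)))"
    using \<rho> es x l min by (intro families_sum_step) (metis nth_mem, auto)
  also have "\<dots> = (\<Sum>y\<in>{1..r + 1}. (Es ! l) x y * path_det r Es (?vs y) es)"
  proof (intro sum.cong refl)
    fix y assume y: "y \<in> {1..r + 1}"
    show "(Es ! l) x y * (if (l + 1, y) \<in> set vs then 0
        else families_sum r Es (length es) (insert (l + 1, y) (set vs - {(l, x)})) (set es)) =
      (Es ! l) x y * path_det r Es (?vs y) es"
    proof (cases "(Es ! l) x y = 0")
      case False
      from step[OF y this] show ?thesis
        unfolding det_formula_def dist set by auto
    qed simp
  qed
  also have "\<dots> = path_det r Es vs es"
    using path_det_step[OF l es \<rho>, of r] by simp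
  finally show ?thesis using True by (simp add: det_formula_def)
qed

text \<open>A height whose matrix row is diagonal allows only a horizontal step. Vertices are moved
  one at a time and collect in \<open>pre\<close>, which is therefore generalised.\<close>

lemma det_formula_straight:
  assumes l: "l < length Es" and es: "\<And>e. e \<in> set es \<Longrightarrow> fst e \<le> length Es \<and> l < fst e"
    and len: "length pre + length xs + length post = length es"
    and xs: "\<And>x. x \<in> set xs \<Longrightarrow> x \<in> {1..r + 1}"
    and diag: "\<And>x y. x \<in> set xs \<Longrightarrow> y \<in> {1..r + 1} \<Longrightarrow> (Es ! l) x y \<noteq> 0 \<Longrightarrow> y = x"
    and min: "\<And>w. w \<in> set pre \<union> set post \<Longrightarrow> l \<le> fst w"
    and goal: "det_formula r Es (pre @ map (Pair (l + 1)) xs @ post) es"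
  shows "det_formula r Es (pre @ map (Pair l) xs @ post) es"
  using len xs diag min goal
proof (induction xs arbitrary: pre)
  case Nil
  then show ?case by simp
next
  case (Cons x xs)
  have "det_formula r Es ((pre @ [(l + 1, x)]) @ map (Pair l) xs @ post) es"
  proof (rule Cons.IH)
    show "length (pre @ [(l + 1, x)]) + length xs + length post = length es"
      using Cons.prems(1) by simp
    show "y \<in> {1..r + 1}" if "y \<in> set xs" for y
      using Cons.prems(2)[of y] that by simp
    show "y = z" if "z \<in> set xs" "y \<in> {1..r + 1}" "(Es ! l) z y \<noteq> 0" for y z
      using Cons.prems(3)[OF _ that(2,3)] that(1) by simp
    show "l \<le> fst w" if "w \<in> set (pre @ [(l + 1, x)]) \<union> set post" for w
      using Cons.prems(4)[of w] that by auto
    show "det_formula r Es ((pre @ [(l + 1, x)]) @ map (Pair (l + 1)) xs @ post) es"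
      using Cons.prems(5) by simp
  qed
  then have next_ok: "det_formula r Es (pre @ (l + 1, x) # map (Pair l) xs @ post) es" by simp
  show ?case
  proof (rule det_formula_step[where \<rho> = "length pre" and l = l and x = x])
    show "(pre @ map (Pair l) (x # xs) @ post) ! length pre = (l, x)" by simp
    fix y assume "y \<in> {1..r + 1}" "(Es ! l) x y \<noteq> 0"
    then have "y = x" using Cons.prems(3) by simp
    then show "det_formula r Es ((pre @ map (Pair l) (x # xs) @ post)[length pre := (l + 1, y)]) es"
      using next_ok by simp
  next
    show "x \<in> {1..r + 1}" using Cons.prems(2) by simp
    show "l \<le> fst w" if "w \<in> set (pre @ map (Pair l) (x # xs) @ post)" for w
      using Cons.prems(4)[of w] that by auto
    show "length pre < length es" "length (pre @ map (Pair l) (x # xs) @ post) = length es"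
      using Cons.prems(1) by simp_all
    show "fst e \<le> length Es \<and> e \<noteq> (l, x)" if "e \<in> set es" for e
      using es[OF that] by auto
  qed (rule l)
qed

text \<open>Diagonal entries are arbitrary; the single off-diagonal position is below the diagonal
  for \<open>elem_H\<close> and above it for \<open>elem_V\<close>.\<close>

definition elementary :: "nat \<Rightarrow> 'f::field matrix \<Rightarrow> bool" where
  "elementary r E \<longleftrightarrow> (\<exists>\<sigma> \<sigma>'. (\<sigma>' = Suc \<sigma> \<or> \<sigma> = Suc \<sigma>') \<and>
     (\<forall>x\<in>{1..r + 1}. \<forall>y\<in>{1..r + 1}. E x y \<noteq> 0 \<longrightarrow> y = x \<or> (x = \<sigma> \<and> y = \<sigma>')))"

text \<open>
  A path can only move to a neighbouring height, so moving all paths across one layer either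
  keeps the heights sorted or makes two paths collide. This is why no signs occur.
\<close>

lemma det_formula_layer:
  assumes l: "l < length Es" and es: "\<And>e. e \<in> set es \<Longrightarrow> fst e \<le> length Es \<and> l < fst e"
    and len: "length fs + length xs = length es"
    and xs: "sorted_wrt (<) xs" "set xs \<subseteq> {1..r + 1}"
    and el: "elementary r (Es ! l)"
    and min: "\<And>w. w \<in> set fs \<Longrightarrow> l \<le> fst w"
    and goal: "\<And>xs'. sorted_wrt (<) xs' \<Longrightarrow> set xs' \<subseteq> {1..r + 1} \<Longrightarrow> length xs' = length xs \<Longrightarrow>
      det_formula r Es (fs @ map (Pair (l + 1)) xs') es"
  shows "det_formula r Es (fs @ map (Pair l) xs) es"
proof -
  obtain \<sigma> \<sigma>' where adj: "\<sigma>' = Suc \<sigma> \<or> \<sigma> = Suc \<sigma>'"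
    and E: "\<And>x y. x \<in> {1..r + 1} \<Longrightarrow> y \<in> {1..r + 1} \<Longrightarrow> (Es ! l) x y \<noteq> 0 \<Longrightarrow> y = x \<or> (x = \<sigma> \<and> y = \<sigma>')"
    using el unfolding elementary_def by blast
  show ?thesis
  proof (cases "\<sigma> \<in> set xs")
    case False
    have 1: "det_formula r Es (fs @ map (Pair (l + 1)) xs @ []) es"
      using goal[OF xs refl] by simp
    have "det_formula r Es (fs @ map (Pair l) xs @ []) es"
    proof (rule det_formula_straight[OF l es _ _ _ _ 1])
      fix x y assume "x \<in> set xs" "y \<in> {1..r + 1}" "(Es ! l) x y \<noteq> 0"
      then show "y = x" using E[of x y] xs(2) False by blast
    qed (use len min xs(2) in auto)
    then show ?thesis by simp
  next
    case True
    then obtain A C where AC: "xs = A @ \<sigma> # C" by (meson split_list)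
    have A: "a < \<sigma>" if "a \<in> set A" for a using xs(1) that by (auto simp: AC sorted_wrt_append)
    have C: "\<sigma> < c" if "c \<in> set C" for c using xs(1) that by (auto simp: AC sorted_wrt_append)
    have diagA: "y = x" if "x \<in> set A \<union> set C" "y \<in> {1..r + 1}" "(Es ! l) x y \<noteq> 0" for x y
      using E[of x y] that A[of x] C[of x] xs(2) by (auto simp: AC)
    let ?A = "map (Pair (l + 1)) A" and ?C = "map (Pair (l + 1)) C"
    have moved: "det_formula r Es (fs @ ?A @ (l + 1, y) # ?C) es" if y: "y \<in> {1..r + 1}" "y = \<sigma> \<or> y = \<sigma>'" for y
    proof (cases "distinct (A @ y # C)")
      case True
      have "sorted_wrt (<) (A @ y # C)"
      proof -
        have "a < y" if "a \<in> set A" for a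
        proof -
          have "a \<noteq> y" using True that by auto
          then show ?thesis using A[OF that] y(2) adj by linarith
        qed
        moreover have "y < c" if "c \<in> set C" for c
        proof -
          have "c \<noteq> y" using True that by auto
          then show ?thesis using C[OF that] y(2) adj by linarith
        qed
        moreover have "sorted_wrt (<) A" "sorted_wrt (<) C" "\<forall>a\<in>set A. \<forall>c\<in>set C. a < c"
          using xs(1) by (auto simp: AC sorted_wrt_append)
        ultimately show ?thesis by (simp add: sorted_wrt_append)
      qed
      then have "det_formula r Es (fs @ map (Pair (l + 1)) (A @ y # C)) es"
        using xs(2) y(1) by (intro goal) (auto simp: AC)
      then show ?thesis by simp
    next
      case False
      then have "\<not> distinct (map (Pair (l + 1)) (A @ y # C))"
        by (metis distinct_map)
      then show ?thesis
        using len by (intro det_formula_not_distinct) (auto simp: AC)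
    qed
    \<comment> \<open>The vertex at height \<open>\<sigma>\<close> moves last. All others of its
      layer then stand in layer \<open>l + 1\<close>, so a step onto an occupied height shows up as
      a repeated vertex.\<close>
    have "det_formula r Es ((fs @ ?A) @ (l, \<sigma>) # ?C) es"
    proof (rule det_formula_step[where \<rho> = "length (fs @ ?A)" and l = l and x = \<sigma>])
      show "((fs @ ?A) @ (l, \<sigma>) # ?C) ! length (fs @ ?A) = (l, \<sigma>)"
        by (rule nth_append_length)
      fix y assume y: "y \<in> {1..r + 1}" "(Es ! l) \<sigma> y \<noteq> 0"
      then have "y = \<sigma> \<or> y = \<sigma>'" using E[of \<sigma> y] xs(2) by (auto simp: AC)
      then show "det_formula r Es (((fs @ ?A) @ (l, \<sigma>) # ?C)[length (fs @ ?A) := (l + 1, y)]) es"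
        using moved[OF y(1)] by (simp only: list_update_length) simp
    next
      show "length (fs @ ?A) < length es" "length ((fs @ ?A) @ (l, \<sigma>) # ?C) = length es"
        using len by (simp_all add: AC)
      show "fst e \<le> length Es \<and> e \<noteq> (l, \<sigma>)" if "e \<in> set es" for e
        using es[OF that] by auto
      show "\<sigma> \<in> {1..r + 1}" using xs(2) by (auto simp: AC)
      show "l \<le> fst w" if "w \<in> set ((fs @ ?A) @ (l, \<sigma>) # ?C)" for w
        using min[of w] that by auto
    qed (rule l)
    then have 1: "det_formula r Es ((fs @ ?A @ [(l, \<sigma>)]) @ map (Pair (l + 1)) C @ []) es" by simp
    have "det_formula r Es ((fs @ ?A @ [(l, \<sigma>)]) @ map (Pair l) C @ []) es"
      by (rule det_formula_straight[OF l es _ _ _ _ 1]) (use len min xs(2) diagA in \<open>auto simp: AC\<close>)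
    then have 2: "det_formula r Es (fs @ map (Pair (l + 1)) A @ (l, \<sigma>) # map (Pair l) C) es" by simp
    have "det_formula r Es (fs @ map (Pair l) A @ (l, \<sigma>) # map (Pair l) C) es"
      by (rule det_formula_straight[OF l es _ _ _ _ 2]) (use len min xs(2) diagA in \<open>auto simp: AC\<close>)
    then show ?thesis by (simp add: AC)
  qed
qed


section \<open>Paths that end in the current layer\<close>

lemma path_sum_same_layer: "path_sum r Es (l, x) (l, y) = unit_state y x"
  by (simp add: path_sum_def)

text \<open>All starts lie in the layer of the end \<open>(l, 1)\<close>, where path sums are
  entries of the identity; hence the first column is a unit vector.\<close>

lemma path_det_end:
  "path_det r Es (map (Pair l) (1 # xs)) ((l, 1) # es) = path_det r Es (map (Pair l) xs) es"
  if "1 \<notin> set xs" "length xs = length es"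
proof -
  let ?n = "length es"
  let ?A = "mat (Suc ?n) (Suc ?n)
    (\<lambda>(i, j). path_sum r Es (map (Pair l) (1 # xs) ! i) (((l, 1) # es) ! j))"
  have "det ?A = (\<Sum>i<Suc ?n. ?A $$ (i, 0) * cofactor ?A i 0)"
    by (rule laplace_expansion_column) auto
  also have "\<dots> = (\<Sum>i<Suc ?n. if i = 0 then cofactor ?A i 0 else 0)"
  proof (rule sum.cong)
    fix i assume i: "i \<in> {..<Suc ?n}"
    have "xs ! m \<noteq> 1" if "i = Suc m" for m
      using that i \<open>1 \<notin> set xs\<close> \<open>length xs = length es\<close>
      by (metis Suc_less_eq lessThan_iff nth_mem)
    then show "?A $$ (i, 0) * cofactor ?A i 0 = (if i = 0 then cofactor ?A i 0 else 0)"
      using i that(2) by (cases i) (auto simp: path_sum_same_layer unit_state_def)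
  qed simp
  also have "\<dots> = cofactor ?A 0 0" by simp
  also have "mat_delete ?A 0 0 = mat ?n ?n (\<lambda>(i, j). path_sum r Es (map (Pair l) xs ! i) (es ! j))"
    using that by (intro eq_matI) (auto simp: mat_delete_def)
  then have "cofactor ?A 0 0 = path_det r Es (map (Pair l) xs) es"
    by (simp add: cofactor_def path_det_def)
  finally show ?thesis by (simp add: path_det_def)
qed

lemma path_det_unreachable:
  assumes "1 \<notin> set xs" "length xs = Suc (length es)"
  shows "path_det r Es (map (Pair l) xs) ((l, 1) # es) = 0"
proof -
  let ?n = "length es"
  let ?A = "mat (Suc ?n) (Suc ?n)
    (\<lambda>(i, j). path_sum r Es (map (Pair l) xs ! i) (((l, 1) # es) ! j))"
  have "det ?A = (\<Sum>i<Suc ?n. ?A $$ (i, 0) * cofactor ?A i 0)"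
    by (rule laplace_expansion_column) auto
  also have "\<dots> = 0"
  proof (rule sum.neutral, rule ballI)
    fix i assume i: "i \<in> {..<Suc ?n}"
    then have "xs ! i \<noteq> 1" using assms by (metis lessThan_iff nth_mem)
    then show "?A $$ (i, 0) * cofactor ?A i 0 = 0"
      using i assms by (simp add: path_sum_same_layer unit_state_def)
  qed
  finally show ?thesis by (simp add: path_det_def)
qed

lemma det_formula_end:
  assumes "1 \<notin> set xs" "distinct xs" "length xs = length es" "(l, 1) \<notin> set es" "l \<le> length Es"
    and IH: "det_formula r Es (map (Pair l) xs) es"
  shows "det_formula r Es (map (Pair l) (1 # xs)) ((l, 1) # es)"
proof -
  have inj: "distinct (map (Pair l) xs)" "distinct (map (Pair l) (1 # xs))"
    using assms by (auto simp: distinct_map inj_on_def)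
  have "families_sum r Es (Suc (length es)) (set (map (Pair l) (1 # xs))) (set ((l, 1) # es)) =
      families_sum r Es (length es) (set (map (Pair l) (1 # xs)) - {(l, 1)}) (set ((l, 1) # es) - {(l, 1)})"
    using assms(5) by (intro families_sum_end) (auto simp: network_def)
  also have "set (map (Pair l) (1 # xs)) - {(l, 1)} = set (map (Pair l) xs)"
    using assms(1) by auto
  also have "set ((l, 1) # es) - {(l, 1)} = set es"
    using assms(4) by auto
  also have "families_sum r Es (length es) (set (map (Pair l) xs)) (set es) =
      path_det r Es (map (Pair l) xs) es"
    using IH inj(1) unfolding det_formula_def by simp
  also have "\<dots> = path_det r Es (map (Pair l) (1 # xs)) ((l, 1) # es)"
    using path_det_end[OF assms(1,3)] by metis
  finally show ?thesis using inj(2) unfolding det_formula_def by simp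
qed

lemma det_formula_unreachable:
  assumes "1 \<notin> set xs" "length xs = Suc (length es)"
  shows "det_formula r Es (map (Pair l) xs) ((l, 1) # es)"
proof -
  have "families_sum r Es (Suc (length es)) (set (map (Pair l) xs)) (set ((l, 1) # es)) = 0"
    using assms(1) by (intro families_sum_unreachable[of "(l, 1)"]) auto
  then show ?thesis
    using path_det_unreachable[OF assms] unfolding det_formula_def by simp
qed

text \<open>
  The starting vertices \<open>fs\<close> lie ahead of the current layer \<open>l\<close>, in which the other paths are
  at the heights \<open>xs\<close>.
\<close>

lemma det_formula_planar:
  assumes el: "\<And>E. E \<in> set Es \<Longrightarrow> elementary r E"
    and "sorted_wrt (<) xs" "set xs \<subseteq> {1..r + 1}"
    and "sorted_wrt (\<lambda>v w. fst w < fst v) fs" "\<And>f. f \<in> set fs \<Longrightarrow> snd f = 1 \<and> l < fst f"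
    and "sorted_wrt (\<lambda>v w. fst v < fst w) es"
    and "\<And>e. e \<in> set es \<Longrightarrow> snd e = 1 \<and> l \<le> fst e \<and> fst e \<le> length Es"
    and "\<And>f e. f \<in> set fs \<Longrightarrow> e \<in> set es \<Longrightarrow> fst f \<le> fst e"
    and "length fs + length xs = length es"
  shows "det_formula r Es (fs @ map (Pair l) xs) es"
  using assms(2-)
\<comment> \<open>Each round either uses up an ending vertex or advances one layer.\<close>
proof (induction "length Es - l + length es" arbitrary: l fs xs es rule: less_induct)
  case less
  note sxs = less.prems(1) and rxs = less.prems(2) and sfs = less.prems(3) and ffs = less.prems(4)
    and ses = less.prems(5) and ees = less.prems(6) and fe = less.prems(7) and len = less.prems(8)
  show ?case
  proof (cases es)
    case Nil
    then have "fs = []" "xs = []" using len by auto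
    then show ?thesis
      using Nil by (simp add: det_formula_def path_det_def families_sum_empty)
  next
    case (Cons e es')
    have e: "e \<in> set es" "snd e = 1" "l \<le> fst e" "fst e \<le> length Es"
      using ees[of e] Cons by auto
    have es': "fst e < fst e'" if "e' \<in> set es'" for e'
      using ses that by (simp add: Cons)
    show ?thesis
    proof (cases "fst e = l")
      case True
      then have el1: "e = (l, 1)" using e(2) by (cases e) simp
      \<comment> \<open>A pending start would lie beyond layer \<open>l\<close>, yet no later than
        \<open>e\<close>, which is in layer \<open>l\<close>.\<close>
      have fs: "fs = []"
      proof (rule ccontr)
        assume "fs \<noteq> []"
        then have "l < fst (hd fs)" "fst (hd fs) \<le> fst e"
          using ffs[of "hd fs"] fe[of "hd fs" e] e(1) by auto
        then show False using True by simp
      qed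
      show ?thesis
      proof (cases "1 \<in> set xs")
        case False
        then have "det_formula r Es (map (Pair l) xs) ((l, 1) # es')"
          using len fs Cons by (intro det_formula_unreachable) auto
        then show ?thesis by (simp add: fs Cons el1)
      next
        case one: True
        then obtain x xs' where xs: "xs = x # xs'" by (cases xs) auto
        have gt: "x < z" if "z \<in> set xs'" for z using sxs that by (simp add: xs)
        have "1 \<le> x" using rxs by (simp add: xs)
        then have x1: "x = 1" using one gt[of 1] by (auto simp: xs)
        have n1: "1 \<notin> set xs'" using gt x1 by blast
        have dist: "distinct xs'" using sxs by (simp add: xs strict_sorted_iff)
        have "det_formula r Es ([] @ map (Pair l) xs') es'"
        proof (rule less.hyps)
          show "length Es - l + length es' < length Es - l + length es" by (simp add: Cons)
          show "sorted_wrt (<) xs'" "set xs' \<subseteq> {1..r + 1}" using sxs rxs by (simp_all add: xs)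
          show "sorted_wrt (\<lambda>v w. fst v < fst w) es'" using ses by (simp add: Cons)
          show "snd e' = 1 \<and> l \<le> fst e' \<and> fst e' \<le> length Es" if "e' \<in> set es'" for e'
            using ees[of e'] that by (simp add: Cons)
          show "length ([] :: (nat \<times> nat) list) + length xs' = length es'"
            using len by (simp add: fs xs Cons)
        qed simp_all
        moreover have "(l, 1) \<notin> set es'" using es'[of "(l, 1)"] True by auto
        ultimately have "det_formula r Es (map (Pair l) (1 # xs')) ((l, 1) # es')"
          using n1 dist len e(3,4)
          by (intro det_formula_end) (auto simp: fs xs Cons)
        then show ?thesis by (simp add: fs Cons el1 xs x1)
      qed
    next
      case False
      then have le: "l < fst e" using e(3) by simp
      then have l: "l < length Es" using e(4) by simp
      have ees': "snd e' = 1 \<and> l < fst e' \<and> fst e' \<le> length Es" if "e' \<in> set es" for e'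
        using ees[OF that] es'[of e'] le that by (auto simp: Cons)
      show ?thesis
      proof (rule det_formula_layer[OF l])
        show "fst e' \<le> length Es \<and> l < fst e'" if "e' \<in> set es" for e'
          using ees'[OF that] by simp
        show "elementary r (Es ! l)" using el l by simp
        show "l \<le> fst w" if "w \<in> set fs" for w using ffs[OF that] by simp
        fix ys assume ys: "sorted_wrt (<) ys" "set ys \<subseteq> {1..r + 1}" "length ys = length xs"
        show "det_formula r Es (fs @ map (Pair (l + 1)) ys) es"
        \<comment> \<open>\<open>fs\<close> is ordered by decreasing layer, so its last entry is the
          next start to be reached.\<close>
        proof (cases "fs \<noteq> [] \<and> fst (last fs) = l + 1")
          case False
          have last_min: "fst (last fs) \<le> fst f" if "f \<in> set fs" for f
            using sfs that by (induction fs) (auto simp: less_imp_le)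
          show ?thesis
          proof (rule less.hyps)
            show "length Es - (l + 1) + length es < length Es - l + length es" using l by simp
            show "snd f = 1 \<and> l + 1 < fst f" if f: "f \<in> set fs" for f
            proof -
              have "fs \<noteq> []" using f by auto
              then have "l < fst (last fs)" "fst (last fs) \<noteq> l + 1"
                using ffs[of "last fs"] False by auto
              then show ?thesis using ffs[OF f] last_min[OF f] by linarith
            qed
            show "snd e' = 1 \<and> l + 1 \<le> fst e' \<and> fst e' \<le> length Es" if "e' \<in> set es" for e'
              using ees'[OF that] by simp
            show "length fs + length ys = length es" using len ys(3) by simp
          qed (use ys sfs ses fe in \<open>simp_all\<close>)
        next
          case True
          then have fl: "last fs = (l + 1, 1)" using ffs[OF last_in_set] by (metis prod.collapse)
          define gs where "gs = butlast fs"
          have fs: "fs = gs @ [(l + 1, 1)]"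
            using True fl unfolding gs_def by (metis append_butlast_last_id)
          show ?thesis
          proof (cases "1 \<in> set ys")
            case one: True
            then have "\<not> distinct (fs @ map (Pair (l + 1)) ys)" by (auto simp: fs)
            then show ?thesis using len ys(3) by (intro det_formula_not_distinct) auto
          next
            case n1: False
            \<comment> \<open>Height 1 is the lowest, so the new start enters at the front of the
              sorted heights, which is the place it already has in the list: no rows are
              permuted.\<close>
            have "det_formula r Es (gs @ map (Pair (l + 1)) (1 # ys)) es"
            proof (rule less.hyps)
              show "length Es - (l + 1) + length es < length Es - l + length es" using l by simp
              have "1 < y" if "y \<in> set ys" for y
              proof -
                have "1 \<le> y" "y \<noteq> 1" using ys(2) n1 that by auto
                then show ?thesis by simp
              qed
              then show "sorted_wrt (<) (1 # ys)" using ys(1) by simp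
              show "set (1 # ys) \<subseteq> {1..r + 1}" using ys(2) by simp
              show "sorted_wrt (\<lambda>v w. fst w < fst v) gs" using sfs by (simp add: fs sorted_wrt_append)
              show "snd f = 1 \<and> l + 1 < fst f" if "f \<in> set gs" for f
                using sfs ffs[of f] that by (auto simp: fs sorted_wrt_append)
              show "snd e' = 1 \<and> l + 1 \<le> fst e' \<and> fst e' \<le> length Es" if "e' \<in> set es" for e'
                using ees'[OF that] by simp
              show "fst f \<le> fst e'" if "f \<in> set gs" "e' \<in> set es" for f e'
                using fe[OF _ that(2), of f] that(1) by (simp add: fs)
              show "length gs + length (1 # ys) = length es" using len ys(3) by (simp add: fs)
            qed (rule ses)
            then show ?thesis by (simp add: fs)
          qed
        qed
      qed (use len sxs rxs in simp_all)
    qed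
  qed
qed


section \<open>The solution as contiguous minors\<close>

locale T_solution =
  fixes r :: nat and T :: "nat \<Rightarrow> int \<Rightarrow> int \<Rightarrow> 'f::field"
  assumes r_pos: "1 \<le> r"
    and T_sys: "T_system r T"
    and T_nz: "\<alpha> \<le> r + 1 \<Longrightarrow> even (int \<alpha> + j + k) \<Longrightarrow> T \<alpha> j k \<noteq> 0"
begin

lemma T_edge: "\<alpha> = 0 \<or> \<alpha> = r + 1 \<Longrightarrow> even (int \<alpha> + j + k) \<Longrightarrow> T \<alpha> j k = 1"
  using T_sys unfolding T_system_def by blast

text \<open>
  In the light-cone coordinates \<open>(i, l)\<close> of the points \<open>(1, j, k)\<close>, the T-system becomes the
  Desnanot-Jacobi identity and \<open>T\<^sub>n\<close> a contiguous \<open>n \<times> n\<close> minor.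
\<close>

definition lc :: "int \<Rightarrow> int \<Rightarrow> 'f" where
  "lc i l = T 1 (l - i) (i + l + 1)"

lemma contig_lc: "n \<le> r + 1 \<Longrightarrow> contig lc n i l = T n (l - i) (i + l + int n)"
proof (induction n arbitrary: i l rule: less_induct)
  case (less n)
  consider "n = 0" | "n = 1" | m where "n = Suc (Suc m)"
    by (metis One_nat_def not0_implies_Suc)
  then show ?case
  proof cases
    case 1
    have "T 0 (l - i) (i + l) = 1"
      by (rule T_edge) auto
    then show ?thesis using 1 by simp
  next
    case 2
    then show ?thesis by (simp add: lc_def)
  next
    case (3 m)
    have m: "m \<le> r + 1" "Suc m \<le> r + 1" "Suc m \<in> {1..r}" using less.prems 3 by auto
    have IH: "contig lc m i l = T m (l - i) (i + l + int m)"
      "contig lc (Suc m) i l = T (Suc m) (l - i) (i + l + int (Suc m))" for i l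
      using less.IH[of m] less.IH[of "Suc m"] m 3 by auto
    \<comment> \<open>With the next column as border all bordered minors become contiguous, and the
      relation turns into the Desnanot-Jacobi identity with central minor of size
      \<open>m\<close>.\<close>
    let ?u = "\<lambda>\<rho>. lc \<rho> (l + int (Suc m))"
    have nz: "contig lc m (i + 1) (l + 1) \<noteq> 0"
      unfolding IH by (rule T_nz) (use m in auto)
    have "contig lc (Suc m) i l * bordered lc (Suc m) (i + 1) (l + 1) ?u =
        contig lc m (i + 1) (l + 1) * bordered lc (Suc (Suc m)) i l ?u +
        contig lc (Suc m) (i + 1) l * bordered lc (Suc m) i (l + 1) ?u"
      by (rule bordered_relation_V[OF nz]) simp
    then have V: "contig lc (Suc m) i l * contig lc (Suc m) (i + 1) (l + 1) =
        contig lc m (i + 1) (l + 1) * contig lc (Suc (Suc m)) i l +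
        contig lc (Suc m) (i + 1) l * contig lc (Suc m) i (l + 1)"
      by (simp add: bordered_next_column)
    \<comment> \<open>\<open>(Suc m, j, k)\<close> is the centre of the T-relation whose six values
      are the minors in \<open>V\<close>.\<close>
    define j where "j = l - i"
    define k where "k = i + l + int m + 2"
    have "odd (int (Suc m) + j + k)" by (simp add: j_def k_def)
    then have rel: "T (Suc m) j (k + 1) * T (Suc m) j (k - 1) =
        T (Suc m) (j + 1) k * T (Suc m) (j - 1) k + T (Suc m + 1) j k * T (Suc m - 1) j k"
      using T_sys m(3) unfolding T_system_def by blast
    have "contig lc m (i + 1) (l + 1) = T m j k"
      "contig lc (Suc m) i l = T (Suc m) j (k - 1)"
      "contig lc (Suc m) (i + 1) (l + 1) = T (Suc m) j (k + 1)"
      "contig lc (Suc m) (i + 1) l = T (Suc m) (j - 1) k"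
      "contig lc (Suc m) i (l + 1) = T (Suc m) (j + 1) k"
      unfolding IH j_def k_def by (simp_all add: algebra_simps)
    with V rel nz have "contig lc (Suc (Suc m)) i l = T (Suc (Suc m)) j k"
      by (simp add: algebra_simps)
    then show ?thesis using 3 by (simp add: j_def k_def algebra_simps)
  qed
qed

lemma contig_lc_nonzero: "n \<le> r + 1 \<Longrightarrow> contig lc n i l \<noteq> 0"
  unfolding contig_lc by (rule T_nz) auto

lemma contig_lc_top: "contig lc (Suc r) i l = 1"
  by (simp only: contig_lc, rule T_edge) auto

text \<open>As minors of size \<open>r + 1\<close> equal 1, the difference of the two sides is a
  nonzero multiple of \<open>?W l\<close>, for first column \<open>l\<close> as well as
  \<open>l + 1\<close>. So equality passes between neighbouring columns in both directions.\<close>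

lemma bordered_lc_top_Suc:
  "bordered lc (Suc r) (i + 1) l (\<lambda>\<rho>. lc \<rho> y) = bordered lc (Suc r) i l (\<lambda>\<rho>. lc \<rho> y)"
proof -
  let ?u = "\<lambda>\<rho>. lc \<rho> y"
  let ?eq = "\<lambda>l. bordered lc (Suc r) (i + 1) l ?u = bordered lc (Suc r) i l ?u"
  let ?W = "\<lambda>l. bordered lc (Suc (Suc r)) i l ?u"
  have V: "?eq l0 \<longleftrightarrow> ?W l = 0" if "l0 = l \<or> l0 = l + 1" for l l0
  proof -
    have nz: "contig lc r (i + 1) l0 \<noteq> 0" by (rule contig_lc_nonzero) simp
    from bordered_relation_V[OF nz that, of ?u]
    have "bordered lc (Suc r) (i + 1) l0 ?u =
        contig lc r (i + 1) l0 * ?W l + bordered lc (Suc r) i l0 ?u"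
      by (simp add: contig_lc_top)
    then show ?thesis using nz by auto
  qed
  have step: "?eq l \<longleftrightarrow> ?eq (l + 1)" for l
    using V[of l l] V[of "l + 1" l] by simp
  show ?thesis
  proof (induction l rule: int_induct[where k = y])
    \<comment> \<open>For \<open>l = y\<close> the border repeats the first column and both sides
      vanish; a first column exists because \<open>r\<close> is positive.\<close>
    case base
    show ?case using r_pos by (simp add: bordered_column_eq_0)
  next
    case (step1 l)
    then show ?case using step by blast
  next
    case (step2 l)
    then show ?case using step[of "l - 1"] by simp
  qed
qed

lemma bordered_lc_top:
  "bordered lc (Suc r) i l (\<lambda>\<rho>. lc \<rho> y) = bordered lc (Suc r) i' l (\<lambda>\<rho>. lc \<rho> y)"
proof -
  have "bordered lc (Suc r) i l (\<lambda>\<rho>. lc \<rho> y) = bordered lc (Suc r) 0 l (\<lambda>\<rho>. lc \<rho> y)" for i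
  proof (induction i rule: int_induct[where k = 0])
    case (step1 i)
    then show ?case by (simp add: bordered_lc_top_Suc)
  next
    case (step2 i)
    then show ?case using bordered_lc_top_Suc[of "i - 1"] by simp
  qed simp
  then show ?thesis by metis
qed

end


section \<open>Action of the slice matrices\<close>

lemma mat_app_elem_H:
  assumes "\<beta> \<in> {1..r}" "x \<in> {1..r + 1}"
  shows "mat_app r (elem_H \<beta> a b u) v x =
    (if x = \<beta> + 1 then u / b * v \<beta> + a / b * v (\<beta> + 1) else v x)"
proof (cases "x = \<beta> + 1")
  case True
  have "mat_app r (elem_H \<beta> a b u) v x =
      (\<Sum>y\<in>{1..r + 1}. (if y = \<beta> then u / b * v y else 0) + (if y = \<beta> + 1 then a / b * v y else 0))"
    unfolding mat_app_def by (rule sum.cong) (auto simp: elem_H_def True)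
  then show ?thesis using assms True by (simp add: sum.distrib)
next
  case False
  have "mat_app r (elem_H \<beta> a b u) v x = (\<Sum>y\<in>{1..r + 1}. if y = x then v y else 0)"
    unfolding mat_app_def using False by (intro sum.cong) (auto simp: elem_H_def)
  then show ?thesis using assms False by simp
qed

lemma mat_app_elem_V:
  assumes "\<beta> \<in> {1..r}" "x \<in> {1..r + 1}"
  shows "mat_app r (elem_V \<beta> c a b) v x =
    (if x = \<beta> then a / b * v \<beta> + c / b * v (\<beta> + 1) else v x)"
proof (cases "x = \<beta>")
  case True
  have "mat_app r (elem_V \<beta> c a b) v x =
      (\<Sum>y\<in>{1..r + 1}. (if y = \<beta> then a / b * v y else 0) + (if y = \<beta> + 1 then c / b * v y else 0))"
    unfolding mat_app_def by (rule sum.cong) (auto simp: elem_V_def True)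
  then show ?thesis using assms True by (simp add: sum.distrib)
next
  case False
  have "mat_app r (elem_V \<beta> c a b) v x = (\<Sum>y\<in>{1..r + 1}. if y = x then v y else 0)"
    unfolding mat_app_def using False by (intro sum.cong) (auto simp: elem_V_def)
  then show ?thesis using assms False by simp
qed

locale T_boundary = T_solution +
  fixes \<kappa> :: "nat \<Rightarrow> int \<Rightarrow> int" and d :: "nat \<Rightarrow> int \<Rightarrow> diagonal"
  assumes adm: "admissible_boundary r \<kappa>" and diag: "admissible_diagonals r \<kappa> d"
begin

text \<open>\<open>lc_row\<close> and \<open>lc_col\<close> solve \<open>t = l - i\<close> and
  \<open>\<kappa> \<beta> t = i + l + int \<beta>\<close>: they give the upper left corner of the
  minor that equals the boundary value. Parity makes the division exact.\<close>

definition lc_row :: "nat \<Rightarrow> int \<Rightarrow> int" where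
  "lc_row \<beta> t = (\<kappa> \<beta> t - t - int \<beta>) div 2"

definition lc_col :: "nat \<Rightarrow> int \<Rightarrow> int" where
  "lc_col \<beta> t = (\<kappa> \<beta> t + t - int \<beta>) div 2"

lemma lc_coords:
  assumes "\<beta> \<in> {1..r}"
  shows "2 * lc_row \<beta> t = \<kappa> \<beta> t - t - int \<beta>" "2 * lc_col \<beta> t = \<kappa> \<beta> t + t - int \<beta>"
proof -
  have e: "even (int \<beta> + t + \<kappa> \<beta> t)"
    using adm assms unfolding admissible_boundary_def by blast
  have "even (\<kappa> \<beta> t - t - int \<beta>)" "even (\<kappa> \<beta> t + t - int \<beta>)" using e by presburger+
  then show "2 * lc_row \<beta> t = \<kappa> \<beta> t - t - int \<beta>" "2 * lc_col \<beta> t = \<kappa> \<beta> t + t - int \<beta>"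
    unfolding lc_row_def lc_col_def by auto
qed

lemma bval_contig: "\<beta> \<in> {1..r} \<Longrightarrow> bval r \<kappa> T \<beta> t = contig lc \<beta> (lc_row \<beta> t) (lc_col \<beta> t)"
  using lc_coords[of \<beta> t] by (subst contig_lc) (auto simp: bval_def intro!: arg_cong2[where f = "T \<beta>"])

text \<open>
  \<open>\<tau> \<beta>\<close> says at which time row \<open>\<beta>\<close> of the boundary is read off. The entries
  \<open>lc_row (r + 1)\<close> and \<open>lc_col 0\<close>, which \<open>\<kappa>\<close> does not determine, are irrelevant.
\<close>

definition state :: "(nat \<Rightarrow> int) \<Rightarrow> int \<Rightarrow> nat \<Rightarrow> 'a" where
  "state \<tau> y x = bordered lc x (if x = r + 1 then 0 else lc_row x (\<tau> x))
     (if x = 1 then 0 else lc_col (x - 1) (\<tau> (x - 1))) (\<lambda>\<rho>. lc \<rho> y)"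

text \<open>The undetermined coordinates may take any value: a bordered minor of size 1 has no
  column of \<open>lc\<close>, and one of size \<open>r + 1\<close> does not depend on its
  rows.\<close>

lemma state_eqI:
  assumes "x \<in> {1..r + 1}"
    and "x \<noteq> r + 1 \<Longrightarrow> lc_row x (\<tau> x) = i"
    and "x \<noteq> 1 \<Longrightarrow> lc_col (x - 1) (\<tau> (x - 1)) = l"
  shows "state \<tau> y x = bordered lc x i l (\<lambda>\<rho>. lc \<rho> y)"
proof -
  have col: "bordered lc x i (if x = 1 then 0 else lc_col (x - 1) (\<tau> (x - 1))) u =
      bordered lc x i l u" for i u
    using assms(3) by auto
  show ?thesis
    unfolding state_def col using assms(2) bordered_lc_top by auto
qed

text \<open>If \<open>\<kappa> \<beta>\<close> rises, only the column of its corner differs between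
  \<open>t\<close> and \<open>t + 1\<close>, so component \<open>\<beta> + 1\<close> changes, by
  relation H; if it falls, only the row differs and component \<open>\<beta>\<close> changes, by
  relation V. \<open>up\<close> and \<open>down\<close> record which neighbours have already been
  passed: for \<open>SW_NE\<close> the factor \<open>\<beta> + 1\<close> stands to the left of
  factor \<open>\<beta>\<close> and acts later.\<close>

lemma state_slice_elem:
  assumes \<beta>: "\<beta> \<in> {1..r}" and \<tau>: "\<tau> \<beta> = t + 1"
    and up: "\<beta> < r \<Longrightarrow> \<tau> (\<beta> + 1) = (if d \<beta> t = SW_NE then t + 1 else t)"
    and down: "1 < \<beta> \<Longrightarrow> \<tau> (\<beta> - 1) = (if d (\<beta> - 1) t = SW_NE then t else t + 1)"
    and x: "x \<in> {1..r + 1}"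
  shows "mat_app r (slice_elem r \<kappa> T d t \<beta>) (state \<tau> y) x = state (\<tau>(\<beta> := t)) y x"
proof -
  let ?\<tau> = "\<tau>(\<beta> := t)"
  let ?u = "\<lambda>\<rho>. lc \<rho> y"
  define i where "i = lc_row \<beta> t"
  define l where "l = lc_col \<beta> t"
  define a where "a = bval r \<kappa> T \<beta> t"
  define b where "b = bval r \<kappa> T \<beta> (t + 1)"
  obtain m where m: "\<beta> = Suc m" using \<beta> by (cases \<beta>) auto
  have dU: "if d \<beta> t = SW_NE then \<kappa> \<beta> t = \<kappa> (\<beta> + 1) (t + 1) else \<kappa> \<beta> (t + 1) = \<kappa> (\<beta> + 1) t"
    if "\<beta> < r"
    using diag \<beta> that unfolding admissible_diagonals_def
    by (cases "d \<beta> t") (fastforce split: diagonal.splits)+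
  have dD: "if d (\<beta> - 1) t = SW_NE then \<kappa> (\<beta> - 1) t = \<kappa> \<beta> (t + 1) else \<kappa> (\<beta> - 1) (t + 1) = \<kappa> \<beta> t"
    if "1 < \<beta>"
  proof -
    have "\<beta> - 1 \<in> {1..<r}" "\<beta> - 1 + 1 = \<beta>" using \<beta> that by auto
    then show ?thesis
      using diag unfolding admissible_diagonals_def
      by (cases "d (\<beta> - 1) t") (metis diagonal.simps(3) diagonal.simps(4) diagonal.simps(2))+
  qed
  note c0 = lc_coords[OF \<beta>, of t] and c1 = lc_coords[OF \<beta>, of "t + 1"]
  have cU: "2 * lc_row (\<beta> + 1) s = \<kappa> (\<beta> + 1) s - s - int (\<beta> + 1)"
    "2 * lc_col (\<beta> + 1) s = \<kappa> (\<beta> + 1) s + s - int (\<beta> + 1)" if "\<beta> < r" for s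
    using lc_coords[of "\<beta> + 1" s] that by auto
  have "\<beta> - 1 \<in> {1..r}" if "1 < \<beta>" using that \<beta> by auto
  then have cD: "2 * lc_row (\<beta> - 1) s = \<kappa> (\<beta> - 1) s - s - int (\<beta> - 1)"
    "2 * lc_col (\<beta> - 1) s = \<kappa> (\<beta> - 1) s + s - int (\<beta> - 1)" if "1 < \<beta>" for s
    using lc_coords[of "\<beta> - 1" s] that by blast+
  have a: "a = contig lc \<beta> i l"
    unfolding a_def i_def l_def by (rule bval_contig[OF \<beta>])
  have b: "b = contig lc \<beta> (lc_row \<beta> (t + 1)) (lc_col \<beta> (t + 1))"
    unfolding b_def by (rule bval_contig[OF \<beta>])
  have b_nz: "b \<noteq> 0"
    unfolding b using \<beta> by (intro contig_lc_nonzero) simp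
  have other: "state ?\<tau> y x = state \<tau> y x" if "x \<noteq> \<beta>" "x \<noteq> \<beta> + 1"
    using that x by (auto simp: state_def)
  show ?thesis
  proof (cases "\<kappa> \<beta> (t + 1) = \<kappa> \<beta> t + 1")
    case True
    have i1: "lc_row \<beta> (t + 1) = i" and l1: "lc_col \<beta> (t + 1) = l + 1"
      using c0 c1 True unfolding i_def l_def by linarith+
    \<comment> \<open>There is no boundary row \<open>r + 1\<close>; any row may stand in for it,
      and \<open>i\<close> meets the hypothesis of relation H. The entry \<open>u = 1\<close> is
      then a minor of size \<open>r + 1\<close>.\<close>
    define i' where "i' = (if \<beta> = r then i else lc_row (\<beta> + 1) (\<tau> (\<beta> + 1)))"
    define u where "u = (if \<beta> = r then 1 else case d \<beta> t of SW_NE \<Rightarrow> bval r \<kappa> T (\<beta> + 1) (t + 1)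
        | NW_SE \<Rightarrow> bval r \<kappa> T (\<beta> + 1) t)"
    have i': "i' = i \<or> i' = i - 1"
      using up dU cU[of t] cU[of "t + 1"] c0 True \<beta> unfolding i'_def i_def
      by (cases "\<beta> = r"; cases "d \<beta> t") auto
    have u: "u = contig lc (Suc \<beta>) i' l"
    proof (cases "\<beta> = r")
      case True
      then show ?thesis by (simp add: u_def contig_lc_top)
    next
      case False
      then have lt: "\<beta> < r" "\<beta> + 1 \<in> {1..r}" using \<beta> by auto
      then have "lc_col (\<beta> + 1) (\<tau> (\<beta> + 1)) = l"
        using up dU cU[of t] cU[of "t + 1"] c0 True unfolding l_def
        by (cases "d \<beta> t") auto
      moreover have "u = bval r \<kappa> T (\<beta> + 1) (\<tau> (\<beta> + 1))"
        using False up lt by (cases "d \<beta> t") (auto simp: u_def)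
      ultimately show ?thesis
        using bval_contig[OF lt(2)] False by (simp add: i'_def)
    qed
    have col: "lc_col (\<beta> - 1) (\<tau> (\<beta> - 1)) = l + 1" if "1 < \<beta>"
      using down dD cD[of t] cD[of "t + 1"] c0 True that unfolding l_def
      by (cases "d (\<beta> - 1) t") auto
    have s1: "state \<tau> y \<beta> = bordered lc \<beta> i (l + 1) ?u"
      using \<beta> col \<tau> i1 by (intro state_eqI) auto
    have s1': "state ?\<tau> y \<beta> = bordered lc \<beta> i (l + 1) ?u"
      using \<beta> col \<tau> i1 by (intro state_eqI) (auto simp: i_def)
    have s2: "state \<tau> y (\<beta> + 1) = bordered lc (\<beta> + 1) i' (l + 1) ?u"
      using \<beta> l1 \<tau> by (intro state_eqI) (auto simp: i'_def)
    have s2': "state ?\<tau> y (\<beta> + 1) = bordered lc (\<beta> + 1) i' l ?u"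
      using \<beta> by (intro state_eqI) (auto simp: i'_def l_def)
    have "slice_elem r \<kappa> T d t \<beta> = elem_H \<beta> a b u"
      by (simp add: slice_elem_def True a_def b_def u_def)
    then have app: "mat_app r (slice_elem r \<kappa> T d t \<beta>) (state \<tau> y) x =
        (if x = \<beta> + 1 then u / b * state \<tau> y \<beta> + a / b * state \<tau> y (\<beta> + 1) else state \<tau> y x)"
      by (simp add: mat_app_elem_H[OF \<beta> x])
    have "b * bordered lc (\<beta> + 1) i' l ?u = u * bordered lc \<beta> i (l + 1) ?u
        + a * bordered lc (\<beta> + 1) i' (l + 1) ?u"
      using bordered_relation_H[of lc m i l i' ?u] i' b_nz
      unfolding a b u i1 l1 unfolding m by simp
    then have "u / b * state \<tau> y \<beta> + a / b * state \<tau> y (\<beta> + 1) = state ?\<tau> y (\<beta> + 1)"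
      unfolding s1 s2 s2' using b_nz by (simp add: field_simps)
    then show ?thesis
      unfolding app using other s1 s1' by (cases "x = \<beta>") auto
  next
    case False
    have "\<bar>\<kappa> \<beta> (t + 1) - \<kappa> \<beta> t\<bar> = 1"
      using adm \<beta> unfolding admissible_boundary_def by blast
    with False have k1: "\<kappa> \<beta> (t + 1) = \<kappa> \<beta> t - 1" by linarith
    have i1: "lc_row \<beta> (t + 1) = i - 1" and l1: "lc_col \<beta> (t + 1) = l"
      using c0 c1 k1 unfolding i_def l_def by linarith+
    \<comment> \<open>For \<open>\<beta> = 1\<close> the column is immaterial; \<open>l\<close>
      meets the hypothesis of relation V, and \<open>v = 1\<close> is the minor of size 0.\<close>
    define l0 where "l0 = (if \<beta> = 1 then l else lc_col (\<beta> - 1) (\<tau> (\<beta> - 1)))"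
    define v where "v = (if \<beta> = 1 then 1 else case d (\<beta> - 1) t of SW_NE \<Rightarrow> bval r \<kappa> T (\<beta> - 1) t
        | NW_SE \<Rightarrow> bval r \<kappa> T (\<beta> - 1) (t + 1))"
    have l0: "l0 = l \<or> l0 = l + 1"
      using down dD cD[of t] cD[of "t + 1"] c0 k1 \<beta> unfolding l0_def l_def
      by (cases "\<beta> = 1"; cases "d (\<beta> - 1) t") auto
    have v: "v = contig lc m i l0"
    proof (cases "\<beta> = 1")
      case True
      then show ?thesis by (simp add: v_def m)
    next
      case False
      then have lt: "1 < \<beta>" "\<beta> - 1 \<in> {1..r}" using \<beta> by auto
      then have "lc_row (\<beta> - 1) (\<tau> (\<beta> - 1)) = i"
        using down dD cD[of t] cD[of "t + 1"] c0 k1 unfolding i_def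
        by (cases "d (\<beta> - 1) t") auto
      moreover have "v = bval r \<kappa> T (\<beta> - 1) (\<tau> (\<beta> - 1))"
        using False down lt by (cases "d (\<beta> - 1) t") (auto simp: v_def)
      ultimately show ?thesis
        using bval_contig[OF lt(2)] False by (simp add: l0_def m)
    qed
    have row: "lc_row (\<beta> + 1) (\<tau> (\<beta> + 1)) = i - 1" if "\<beta> < r"
      using up dU cU[of t] cU[of "t + 1"] c0 k1 that unfolding i_def
      by (cases "d \<beta> t") auto
    have s1: "state \<tau> y \<beta> = bordered lc \<beta> (i - 1) l0 ?u"
      using \<beta> \<tau> i1 by (intro state_eqI) (auto simp: l0_def)
    have s1': "state ?\<tau> y \<beta> = bordered lc \<beta> i l0 ?u"
      using \<beta> by (intro state_eqI) (auto simp: i_def l0_def)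
    have s2: "state \<tau> y (\<beta> + 1) = bordered lc (\<beta> + 1) (i - 1) l ?u"
      using \<beta> l1 \<tau> row by (intro state_eqI) auto
    have s2': "state ?\<tau> y (\<beta> + 1) = bordered lc (\<beta> + 1) (i - 1) l ?u"
      using \<beta> row by (intro state_eqI) (auto simp: l_def)
    have "slice_elem r \<kappa> T d t \<beta> = elem_V \<beta> v a b"
      by (simp add: slice_elem_def False a_def b_def v_def)
    then have app: "mat_app r (slice_elem r \<kappa> T d t \<beta>) (state \<tau> y) x =
        (if x = \<beta> then a / b * state \<tau> y \<beta> + v / b * state \<tau> y (\<beta> + 1) else state \<tau> y x)"
      by (simp add: mat_app_elem_V[OF \<beta> x])
    have nz: "contig lc m i l0 \<noteq> 0"
      using \<beta> m by (intro contig_lc_nonzero) simp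
    have "b * bordered lc \<beta> i l0 ?u = v * bordered lc (\<beta> + 1) (i - 1) l ?u
        + a * bordered lc \<beta> (i - 1) l0 ?u"
      using bordered_relation_V[of lc m "i - 1" l0 l ?u] l0 nz
      unfolding a b v i1 l1 unfolding m by simp
    then have "a / b * state \<tau> y \<beta> + v / b * state \<tau> y (\<beta> + 1) = state ?\<tau> y \<beta>"
      unfolding s1 s2 s1' using b_nz by (simp add: field_simps)
    then show ?thesis
      unfolding app using other s2 s2' by (cases "x = \<beta> + 1") auto
  qed
qed

end


section \<open>Products of whole slices and the column of a boundary point\<close>

lemma slice_factors_same [simp]: "slice_factors r \<kappa> T d s s = []"
  by (simp add: slice_factors_def)

lemma slice_factors_append:
  assumes "s \<le> t" "t \<le> t'"
  shows "slice_factors r \<kappa> T d s t' = slice_factors r \<kappa> T d s t @ slice_factors r \<kappa> T d t t'"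
proof -
  have "[s..t' - 1] = [s..t - 1] @ [t..t' - 1]"
    using assms upto_split1[of s t "t' - 1"] upto_split2[of s "t - 1" "t' - 1"]
    by (cases "t < t'"; cases "s < t") auto
  then show ?thesis by (simp add: slice_factors_def)
qed

context T_boundary
begin

abbreviation "factors \<equiv> slice_factors r \<kappa> T d"

lemma state_cong:
  assumes "\<And>x. x \<in> {1..r} \<Longrightarrow> \<tau> x = \<tau>' x" "x \<in> {1..r + 1}"
  shows "state \<tau> y x = state \<tau>' y x"
proof -
  have "x \<noteq> r + 1 \<Longrightarrow> \<tau> x = \<tau>' x" "x \<noteq> 1 \<Longrightarrow> \<tau> (x - 1) = \<tau>' (x - 1)"
    using assms(2) by (auto intro!: assms(1))
  then show ?thesis using r_pos by (auto simp: state_def)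
qed

text \<open>The newest factor acts after the others for \<open>SW_NE\<close> and before them for
  \<open>NW_SE\<close>. In the second case the induction hypothesis is needed with row
  \<open>\<beta> + 1\<close> already at time \<open>t\<close>, hence the arbitrary
  \<open>\<tau>\<close>.\<close>

lemma state_slice_partial:
  assumes "1 \<le> \<beta>" "\<beta> \<le> r" "\<And>x. x \<in> {1..\<beta>} \<Longrightarrow> \<tau> x = t + 1"
    and "\<beta> < r \<Longrightarrow> \<tau> (\<beta> + 1) = (if d \<beta> t = SW_NE then t + 1 else t)"
    and "x \<in> {1..r + 1}"
  shows "mat_apps r (slice_partial r \<kappa> T d t \<beta>) (state \<tau> y) x =
    state (\<lambda>x. if x \<in> {1..\<beta>} then t else \<tau> x) y x"
  using assms
proof (induction \<beta> arbitrary: \<tau> x rule: nat_induct_at_least)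
  case base
  have "mat_app r (slice_elem r \<kappa> T d t 1) (state \<tau> y) x = state (\<tau>(1 := t)) y x"
    using base by (intro state_slice_elem) auto
  also have "\<dots> = state (\<lambda>x. if x \<in> {1..1} then t else \<tau> x) y x"
    using base by (intro state_cong) auto
  finally show ?case by simp
next
  case (Suc \<beta>)
  then obtain \<gamma> where \<gamma>: "\<beta> = Suc \<gamma>" by (cases \<beta>) auto
  let ?X = "slice_elem r \<kappa> T d t (Suc \<beta>)" and ?P = "slice_partial r \<kappa> T d t \<beta>"
  show ?case
  proof (cases "d \<beta> t")
    case SW_NE
    let ?\<tau> = "\<lambda>x. if x \<in> {1..\<beta>} then t else \<tau> x"
    have IH: "mat_apps r ?P (state \<tau> y) x = state ?\<tau> y x" if "x \<in> {1..r + 1}" for x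
      by (rule Suc.IH) (use Suc.prems that SW_NE in auto)
    have "mat_apps r (slice_partial r \<kappa> T d t (Suc \<beta>)) (state \<tau> y) x =
        mat_app r ?X (mat_apps r ?P (state \<tau> y)) x"
      by (simp add: \<gamma> SW_NE[unfolded \<gamma>])
    also have "\<dots> = mat_app r ?X (state ?\<tau> y) x"
      by (rule mat_app_cong) (rule IH)
    also have "\<dots> = state (?\<tau>(Suc \<beta> := t)) y x"
      by (rule state_slice_elem) (use Suc.prems Suc.hyps SW_NE in auto)
    also have "\<dots> = state (\<lambda>x. if x \<in> {1..Suc \<beta>} then t else \<tau> x) y x"
      by (rule state_cong) (use Suc.prems in auto)
    finally show ?thesis .
  next
    case NW_SE
    let ?\<tau> = "\<tau>(Suc \<beta> := t)"
    have X: "mat_app r ?X (state \<tau> y) x = state ?\<tau> y x" if "x \<in> {1..r + 1}" for x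
      by (rule state_slice_elem) (use Suc.prems Suc.hyps NW_SE that in auto)
    have "mat_apps r (slice_partial r \<kappa> T d t (Suc \<beta>)) (state \<tau> y) x =
        mat_apps r ?P (mat_app r ?X (state \<tau> y)) x"
      by (simp add: \<gamma> NW_SE[unfolded \<gamma>])
    also have "\<dots> = mat_apps r ?P (state ?\<tau> y) x"
      by (rule mat_apps_cong) (use X Suc.prems in auto)
    also have "\<dots> = state (\<lambda>x. if x \<in> {1..\<beta>} then t else ?\<tau> x) y x"
      by (rule Suc.IH) (use Suc.prems NW_SE in auto)
    also have "\<dots> = state (\<lambda>x. if x \<in> {1..Suc \<beta>} then t else \<tau> x) y x"
      by (rule state_cong) (use Suc.prems in auto)
    finally show ?thesis .
  qed
qed

lemma state_factors:
  assumes "s \<le> t" "x \<in> {1..r + 1}"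
  shows "mat_apps r (factors s t) (state (\<lambda>_. t) y) x = state (\<lambda>_. s) y x"
  using assms
proof (induction t arbitrary: x rule: int_ge_induct)
  case base
  then show ?case by simp
next
  case (step t)
  have one: "factors t (t + 1) = slice_partial r \<kappa> T d t r"
    by (simp add: slice_factors_def)
  have "mat_apps r (factors s (t + 1)) (state (\<lambda>_. t + 1) y) x =
      mat_apps r (factors s t) (mat_apps r (slice_partial r \<kappa> T d t r) (state (\<lambda>_. t + 1) y)) x"
    using step.hyps by (simp add: slice_factors_append[of s t "t + 1"] one)
  also have "\<dots> = mat_apps r (factors s t) (state (\<lambda>_. t) y) x"
  proof (rule mat_apps_cong[OF _ step.prems])
    fix x assume x: "x \<in> {1..r + 1}"
    have "mat_apps r (slice_partial r \<kappa> T d t r) (state (\<lambda>_. t + 1) y) x =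
        state (\<lambda>x. if x \<in> {1..r} then t else t + 1) y x"
      by (rule state_slice_partial) (use r_pos x in auto)
    also have "\<dots> = state (\<lambda>_. t) y x"
      by (rule state_cong) (use x in auto)
    finally show "mat_apps r (slice_partial r \<kappa> T d t r) (state (\<lambda>_. t + 1) y) x =
        state (\<lambda>_. t) y x" .
  qed
  also have "\<dots> = state (\<lambda>_. s) y x"
    using step by blast
  finally show ?case .
qed

lemma lc_boundary: "lc (lc_row 1 t) (lc_col 1 t) = T 1 t (\<kappa> 1 t)"
  using lc_coords[of 1 t] r_pos unfolding lc_def
  by (intro arg_cong2[where f = "T 1"]) auto

text \<open>From one boundary row to the next the corner column stays or drops by one. So each minor
  at time \<open>t\<close> contains the column \<open>lc_col 1 t\<close>.\<close>

lemma lc_col_range: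
  assumes "1 \<le> x" "x \<le> r"
  shows "lc_col x t \<le> lc_col 1 t \<and> lc_col 1 t < lc_col x t + int x"
  using assms
proof (induction x rule: nat_induct_at_least)
  case base
  then show ?case by simp
next
  case (Suc x)
  have "\<bar>\<kappa> (x + 1) t - \<kappa> x t\<bar> = 1"
    using adm Suc unfolding admissible_boundary_def by simp
  moreover have "2 * lc_col x t = \<kappa> x t + t - int x"
    "2 * lc_col (Suc x) t = \<kappa> (x + 1) t + t - int (Suc x)"
    using lc_coords(2)[of x t] lc_coords(2)[of "Suc x" t] Suc by auto
  ultimately have "lc_col (Suc x) t = lc_col x t \<or> lc_col (Suc x) t = lc_col x t - 1"
    by linarith
  then show ?case using Suc by auto
qed

text \<open>Every component beyond the first repeats the border column and vanishes; the first is
  the boundary value itself.\<close>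

lemma state_boundary_column:
  assumes "x \<in> {1..r + 1}"
  shows "state (\<lambda>_. t) (lc_col 1 t) x = unit_state 1 x * T 1 t (\<kappa> 1 t)"
proof (cases "x = 1")
  case True
  then show ?thesis
    using r_pos lc_boundary by (simp add: state_def unit_state_def)
next
  case False
  then obtain m where m: "x = Suc m" "1 \<le> m" "m \<le> r"
    using assms by (cases x) auto
  then show ?thesis
    using lc_col_range[of m t] by (auto simp: state_def unit_state_def bordered_column_eq_0)
qed

text \<open>Transporting this multiple of a unit vector from \<open>t\<close> to \<open>s\<close>
  and reading off component 1, which is a single entry of \<open>lc\<close>, gives the path
  sum.\<close>

lemma path_sum_factors:
  assumes "s \<le> t"
  shows "mat_apps r (factors s t) (unit_state 1) 1 * T 1 t (\<kappa> 1 t) =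
    lc (lc_row 1 s) (lc_col 1 t)"
proof -
  have 1: "1 \<in> {1..r + 1}" by simp
  have "mat_apps r (factors s t) (unit_state 1) 1 * T 1 t (\<kappa> 1 t) =
      mat_apps r (factors s t) (state (\<lambda>_. t) (lc_col 1 t)) 1"
    unfolding mat_apps_scale[symmetric] 
    by (rule mat_apps_cong[OF state_boundary_column[symmetric] 1])
  also have "\<dots> = state (\<lambda>_. s) (lc_col 1 t) 1"
    by (rule state_factors[OF assms 1])
  also have "\<dots> = lc (lc_row 1 s) (lc_col 1 t)"
    using r_pos by (simp add: state_def)
  finally show ?thesis .
qed

end


section \<open>End points of the paths\<close>

lemma int_function_onto:
  fixes f :: "int \<Rightarrow> int"
  assumes step: "\<And>t. \<bar>f (t + 1) - f t\<bar> \<le> 1" and near: "\<And>t. \<bar>2 * f t - t\<bar> \<le> B"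
  obtains t where "f t = c"
proof -
  have B: "0 \<le> B" using near[of 0] by linarith
  \<comment> \<open>At \<open>2 * c - B\<close> and \<open>2 * c + B\<close> the bound forces
    \<open>f\<close> to be at most and at least \<open>c\<close>; unit steps give the value in
    between.\<close>
  let ?g = "\<lambda>n. f (2 * c - B + int n)"
  have "\<bar>?g (Suc n) - ?g n\<bar> \<le> 1" for n
    using step[of "2 * c - B + int n"] by (simp add: algebra_simps)
  moreover have "?g 0 \<le> c" using near[of "2 * c - B"] by simp
  moreover have "c \<le> ?g (nat (2 * B))" using near[of "B + 2 * c"] B by simp
  ultimately have "\<exists>n. ?g n = c"
    using nat_intermed_int_val[of 0 "nat (2 * B)" ?g c] by auto
  then show ?thesis using that by blast
qed

lemma det_scale_columns:
  "det (mat n n (\<lambda>(i, j). A i j * c j)) = (\<Prod>j<n. c j) * det (mat n n (\<lambda>(i, j). A i j))"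
  for c :: "nat \<Rightarrow> 'a::comm_ring_1"
proof -
  have "(\<Prod>i = 0..<n. A i (p i) * c (p i)) = (\<Prod>j<n. c j) * (\<Prod>i = 0..<n. A i (p i))"
    if "p permutes {0..<n}" for p
    using prod.permute[OF that, of c] by (simp add: prod.distrib lessThan_atLeast0 mult.commute o_def)
  then show ?thesis
    by (subst (1 2) det_def'[of _ n]) (auto simp: sum_distrib_left mult.left_commute
        permutes_in_image intro!: sum.cong)
qed

lemma elementary_elem_H: "elementary r (elem_H \<beta> a b u)"
  unfolding elementary_def by (rule exI[of _ "\<beta> + 1"], rule exI[of _ \<beta>]) (auto simp: elem_H_def)

lemma elementary_elem_V: "elementary r (elem_V \<beta> v a b)"
  unfolding elementary_def by (rule exI[of _ \<beta>], rule exI[of _ "\<beta> + 1"]) (auto simp: elem_V_def)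

lemma elementary_slice_partial:
  "E \<in> set (slice_partial r \<kappa> T d t \<beta>) \<Longrightarrow> elementary r E"
  by (induction t \<beta> rule: slice_partial.induct)
    (auto simp: slice_elem_def elementary_elem_H elementary_elem_V split: diagonal.splits)

lemma elementary_slice_factors: "E \<in> set (slice_factors r \<kappa> T d s t) \<Longrightarrow> elementary r E"
  using elementary_slice_partial by (auto simp: slice_factors_def)

lemma length_slice_partial: "length (slice_partial r \<kappa> T d t \<beta>) = \<beta>"
  by (induction t \<beta> rule: slice_partial.induct) (auto split: diagonal.splits)

lemma length_slice_factors: "length (slice_factors r \<kappa> T d s t) = nat (t - s) * r"
  by (simp add: slice_factors_def length_concat length_slice_partial o_def sum_list_triv)

section \<open>The first boundary row in light-cone coordinates\<close>

context T_boundary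
begin

lemma lc_row_step: "lc_row 1 (t + 1) = lc_row 1 t \<or> lc_row 1 (t + 1) = lc_row 1 t - 1"
  and lc_col_step: "lc_col 1 (t + 1) = lc_col 1 t \<or> lc_col 1 (t + 1) = lc_col 1 t + 1"
proof -
  have 1: "1 \<in> {1..r}" using r_pos by simp
  have "\<bar>\<kappa> 1 (t + 1) - \<kappa> 1 t\<bar> = 1"
    using adm 1 unfolding admissible_boundary_def by blast
  then show "lc_row 1 (t + 1) = lc_row 1 t \<or> lc_row 1 (t + 1) = lc_row 1 t - 1"
    "lc_col 1 (t + 1) = lc_col 1 t \<or> lc_col 1 (t + 1) = lc_col 1 t + 1"
    using lc_coords[OF 1, of t] lc_coords[OF 1, of "t + 1"] by linarith+
qed

lemma lc_row_antimono: "s \<le> t \<Longrightarrow> lc_row 1 t \<le> lc_row 1 s"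
proof (induction t rule: int_ge_induct)
  case (step t)
  then show ?case using lc_row_step[of t] by linarith
qed simp

lemma lc_col_mono: "s \<le> t \<Longrightarrow> lc_col 1 s \<le> lc_col 1 t"
proof (induction t rule: int_ge_induct)
  case (step t)
  then show ?case using lc_col_step[of t] by linarith
qed simp

lemma lc_bounded:
  obtains B where "\<And>t. \<bar>2 * (- lc_row 1 t) - t\<bar> \<le> B" "\<And>t. \<bar>2 * lc_col 1 t - t\<bar> \<le> B"
proof -
  obtain B where B: "\<And>\<alpha> j. \<alpha> \<in> {1..r} \<Longrightarrow> \<bar>\<kappa> \<alpha> j\<bar> \<le> B"
    using admissible_boundary_bounded[OF adm] by blast
  have 1: "1 \<in> {1..r}" using r_pos by simp
  have "\<bar>2 * (- lc_row 1 t) - t\<bar> \<le> B + 1" "\<bar>2 * lc_col 1 t - t\<bar> \<le> B + 1" for t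
    using lc_coords[OF 1, of t] B[OF 1, of t] by linarith+
  then show ?thesis using that by blast
qed

text \<open>Both coordinates stay within bounded distance of \<open>- t / 2\<close> and
  \<open>t / 2\<close> and move by at most one. So each value is attained, and only finitely often,
  which makes \<open>Max\<close> and \<open>Min\<close> genuine.\<close>

lemma lc_row_Max: "lc_row 1 (Max {t. lc_row 1 t = c}) = c"
  and lc_col_Min: "lc_col 1 (Min {t. lc_col 1 t = c}) = c"
proof -
  obtain B where B: "\<And>t. \<bar>2 * (- lc_row 1 t) - t\<bar> \<le> B" "\<And>t. \<bar>2 * lc_col 1 t - t\<bar> \<le> B"
    using lc_bounded by blast
  have "\<bar>- lc_row 1 (t + 1) - - lc_row 1 t\<bar> \<le> 1" "\<bar>lc_col 1 (t + 1) - lc_col 1 t\<bar> \<le> 1" for t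
    using lc_row_step[of t] lc_col_step[of t] by auto
  then obtain t t' where "- lc_row 1 t = - c" "lc_col 1 t' = c"
    using int_function_onto[of "\<lambda>t. - lc_row 1 t" B "- c"] int_function_onto[of "lc_col 1" B c] B
    by metis
  then have ne: "{t. lc_row 1 t = c} \<noteq> {}" "{t. lc_col 1 t = c} \<noteq> {}" by auto
  have "- 2 * c - B \<le> t \<and> t \<le> - 2 * c + B" if "lc_row 1 t = c" for t
    using B(1)[of t] that by linarith
  then have "{t. lc_row 1 t = c} \<subseteq> {- 2 * c - B..- 2 * c + B}" by auto
  moreover have "2 * c - B \<le> t \<and> t \<le> 2 * c + B" if "lc_col 1 t = c" for t
    using B(2)[of t] that by linarith
  then have "{t. lc_col 1 t = c} \<subseteq> {2 * c - B..2 * c + B}" by auto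
  ultimately have fin: "finite {t. lc_row 1 t = c}" "finite {t. lc_col 1 t = c}"
    using finite_subset by blast+
  show "lc_row 1 (Max {t. lc_row 1 t = c}) = c" "lc_col 1 (Min {t. lc_col 1 t = c}) = c"
    using Max_in[OF fin(1) ne(1)] Min_in[OF fin(2) ne(2)] by auto
qed

text \<open>\<open>(i0, l0)\<close> is the corner of the minor equal to
  \<open>T \<alpha> j k\<close>; \<open>j0\<close> picks a boundary time in its \<open>a\<close>-th
  row, as \<open>j1\<close> does for its \<open>b\<close>-th column.\<close>

lemma lc_row_j0:
  assumes "2 * i0 = k - j - int \<alpha>"
  shows "lc_row 1 (j0 \<kappa> \<alpha> j k a) = i0 + int a - 1"
proof -
  have 1: "1 \<in> {1..r}" using r_pos by simp
  have "t - \<kappa> 1 t = j - k - 2 * int a + int \<alpha> + 1 \<longleftrightarrow> lc_row 1 t = i0 + int a - 1" for t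
    using lc_coords(1)[OF 1, of t] assms by auto
  then show ?thesis unfolding j0_def by (simp only: lc_row_Max)
qed

lemma lc_col_j1:
  assumes "2 * l0 = j + k - int \<alpha>"
  shows "lc_col 1 (j1 \<kappa> \<alpha> j k b) = l0 + int b - 1"
proof -
  have 1: "1 \<in> {1..r}" using r_pos by simp
  have "t + \<kappa> 1 t = j + k + 2 * int b - int \<alpha> - 1 \<longleftrightarrow> lc_col 1 t = l0 + int b - 1" for t
    using lc_coords(2)[OF 1, of t] assms by auto
  then show ?thesis unfolding j1_def by (simp only: lc_col_Min)
qed

lemma path_sum_positions:
  assumes "M \<le> s" "s \<le> t" "t \<le> M'"
  shows "path_sum r (factors M M') (length (factors M s), 1) (length (factors M t), 1) =
    mat_apps r (factors s t) (unit_state 1) 1"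
proof -
  have "factors M M' = factors M s @ factors s M'" "factors s M' = factors s t @ factors t M'"
    "factors M t = factors M s @ factors s t"
    using assms by (auto intro!: slice_factors_append)
  then show ?thesis by (simp add: path_sum_def)
qed

end


section \<open>Assembling the determinant of path sums\<close>

context T_boundary
begin

text \<open>Multiplying column \<open>b\<close> of the path determinant by the boundary value at
  \<open>j1(b)\<close> turns its entries into those of the minor for \<open>T \<alpha> j k\<close>;
  this is the origin of the product in front.\<close>

lemma T_eq_families_sum:
  assumes \<alpha>: "1 \<le> \<alpha>" "\<alpha> \<le> r" and ev: "even (int \<alpha> + j + k)"
    and le: "\<And>a b. a \<in> {1..\<alpha>} \<Longrightarrow> b \<in> {1..\<alpha>} \<Longrightarrow> j0 \<kappa> \<alpha> j k a \<le> j1 \<kappa> \<alpha> j k b"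
    and M: "\<And>a. a \<in> {1..\<alpha>} \<Longrightarrow> M \<le> j0 \<kappa> \<alpha> j k a"
    and M': "\<And>b. b \<in> {1..\<alpha>} \<Longrightarrow> j1 \<kappa> \<alpha> j k b \<le> M'"
  defines "pos \<equiv> (\<lambda>t. length (factors M t))"
  shows "T \<alpha> j k =
    (\<Prod>b\<in>{1..\<alpha>}. T 1 (j1 \<kappa> \<alpha> j k b) (\<kappa> 1 (j1 \<kappa> \<alpha> j k b))) *
    families_sum r (factors M M') \<alpha>
      {(pos (j0 \<kappa> \<alpha> j k a), 1) | a. a \<in> {1..\<alpha>}} {(pos (j1 \<kappa> \<alpha> j k b), 1) | b. b \<in> {1..\<alpha>}}"
proof -
  let ?Es = "factors M M'"
  let ?J0 = "j0 \<kappa> \<alpha> j k" and ?J1 = "j1 \<kappa> \<alpha> j k"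
  define i0 where "i0 = (k - j - int \<alpha>) div 2"
  define l0 where "l0 = (j + k - int \<alpha>) div 2"
  have "even (k - j - int \<alpha>)" "even (j + k - int \<alpha>)" using ev by presburger+
  then have i0: "2 * i0 = k - j - int \<alpha>" and l0: "2 * l0 = j + k - int \<alpha>"
    by (auto simp: i0_def l0_def)
  have J0_less: "?J0 a' < ?J0 a" if "a < a'" for a a'
    using lc_row_antimono[of "?J0 a" "?J0 a'"] lc_row_j0[OF i0] that by force
  have J1_less: "?J1 b < ?J1 b'" if "b < b'" for b b'
    using lc_col_mono[of "?J1 b'" "?J1 b"] lc_col_j1[OF l0] that by force
  have pos_less: "pos s < pos t" if "M \<le> s" "s < t" for s t
    using that r_pos by (simp add: pos_def length_slice_factors)
  have pos_le: "pos s \<le> pos t" if "M \<le> s" "s \<le> t" for s t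
    using pos_less[of s t] that by (cases "s = t") auto
  have MJ1: "M \<le> ?J1 b" if "b \<in> {1..\<alpha>}" for b
    using M[OF that] le[OF that that] by linarith
  define gs where "gs = map (\<lambda>a. (pos (?J0 a), 1::nat)) [1..<\<alpha>]"
  define vs where "vs = map (\<lambda>a. (pos (?J0 a), 1::nat)) [1..<Suc \<alpha>]"
  define es where "es = map (\<lambda>b. (pos (?J1 b), 1::nat)) [1..<Suc \<alpha>]"
  have len_es: "length es = \<alpha>" by (simp add: es_def)
  \<comment> \<open>Starting times decrease with \<open>a\<close>, so \<open>a = \<alpha>\<close> is
    the earliest start: it opens the first layer at height 1, and the others wait in
    \<open>gs\<close>.\<close>
  have vs_eq: "vs = gs @ map (Pair (pos (?J0 \<alpha>))) [1]"
    using \<alpha> by (simp add: vs_def gs_def)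
  have "det_formula r ?Es (gs @ map (Pair (pos (?J0 \<alpha>))) [1]) es"
  proof (rule det_formula_planar)
    show "elementary r E" if "E \<in> set ?Es" for E
      using that by (rule elementary_slice_factors)
    show "sorted_wrt (\<lambda>v w. fst w < fst v) gs"
      unfolding gs_def sorted_wrt_map
      by (rule sorted_wrt_mono_rel[OF _ sorted_wrt_upt]) (auto intro!: pos_less J0_less M)
    show "snd f = 1 \<and> pos (?J0 \<alpha>) < fst f" if "f \<in> set gs" for f
      using that \<alpha> by (auto simp: gs_def intro!: pos_less J0_less M)
    show "sorted_wrt (\<lambda>v w. fst v < fst w) es"
      unfolding es_def sorted_wrt_map
      by (rule sorted_wrt_mono_rel[OF _ sorted_wrt_upt]) (auto intro!: pos_less J1_less MJ1)
    show "snd e = 1 \<and> pos (?J0 \<alpha>) \<le> fst e \<and> fst e \<le> length ?Es" if "e \<in> set es" for e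
    proof -
      obtain b where b: "b \<in> {1..\<alpha>}" "e = (pos (?J1 b), 1)"
        using \<open>e \<in> set es\<close> unfolding es_def set_map set_upt
        by (metis (no_types, lifting) imageE atLeastLessThanSuc_atLeastAtMost)
      have "pos (?J1 b) \<le> pos M'" using MJ1[OF b(1)] M'[OF b(1)] by (rule pos_le)
      moreover have "pos (?J0 \<alpha>) \<le> pos (?J1 b)"
        using \<alpha> b(1) by (intro pos_le M le) auto
      ultimately show ?thesis using b(2) by (simp add: pos_def)
    qed
    show "fst f \<le> fst e" if "f \<in> set gs" "e \<in> set es" for f e
      using that \<alpha> by (auto simp: gs_def es_def intro!: pos_le M le)
  qed (use \<alpha> in \<open>auto simp: gs_def es_def\<close>)
  then have "det_formula r ?Es vs es" by (simp only: vs_eq)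
  moreover have "distinct vs"
  proof -
    have "inj_on (\<lambda>a. (pos (?J0 a), 1::nat)) {1..<Suc \<alpha>}"
    proof (rule linorder_inj_onI')
      fix a a' assume "a \<in> {1..<Suc \<alpha>}" "a' \<in> {1..<Suc \<alpha>}" "a < a'"
      then have "pos (?J0 a') < pos (?J0 a)" by (intro pos_less J0_less M) auto
      then show "(pos (?J0 a), 1::nat) \<noteq> (pos (?J0 a'), 1)" by simp
    qed
    then show ?thesis by (simp add: vs_def distinct_map del: upt_Suc)
  qed
  ultimately have "families_sum r ?Es \<alpha> (set vs) (set es) = path_det r ?Es vs es"
    by (simp add: det_formula_def len_es)
  moreover have "set vs = {(pos (?J0 a), 1) | a. a \<in> {1..\<alpha>}}"
    "set es = {(pos (?J1 b), 1) | b. b \<in> {1..\<alpha>}}"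
    by (auto simp: vs_def es_def)
  moreover have "(\<Prod>b\<in>{1..\<alpha>}. T 1 (?J1 b) (\<kappa> 1 (?J1 b))) * path_det r ?Es vs es = T \<alpha> j k"
  proof -
    define c where "c t = T 1 (?J1 (Suc t)) (\<kappa> 1 (?J1 (Suc t)))" for t
    have nth: "vs ! s = (pos (?J0 (Suc s)), 1)" "es ! s = (pos (?J1 (Suc s)), 1)" if "s < \<alpha>" for s
      using that by (simp_all add: vs_def es_def del: upt_Suc)
    have "path_sum r ?Es (vs ! s) (es ! t) * c t = lc (i0 + int s) (l0 + int t)"
      if "s < \<alpha>" "t < \<alpha>" for s t
    proof -
      have st: "Suc s \<in> {1..\<alpha>}" "Suc t \<in> {1..\<alpha>}" using that by auto
      have "path_sum r ?Es (vs ! s) (es ! t) * c t = lc (lc_row 1 (?J0 (Suc s))) (lc_col 1 (?J1 (Suc t)))"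
        unfolding nth(1)[OF that(1)] nth(2)[OF that(2)] pos_def c_def
        using st by (simp only: path_sum_positions[OF M le M'] path_sum_factors[OF le])
      then show ?thesis unfolding lc_row_j0[OF i0] lc_col_j1[OF l0] by (simp add: algebra_simps)
    qed
    then have "contig lc \<alpha> i0 l0 = det (mat \<alpha> \<alpha> (\<lambda>(s, t). path_sum r ?Es (vs ! s) (es ! t) * c t))"
      unfolding contig_def by (intro arg_cong[where f = det] eq_matI) auto
    also have "\<dots> = (\<Prod>t<\<alpha>. c t) * path_det r ?Es vs es"
      by (simp add: det_scale_columns path_det_def len_es)
    also have "(\<Prod>t<\<alpha>. c t) = (\<Prod>b\<in>{1..\<alpha>}. T 1 (?J1 b) (\<kappa> 1 (?J1 b)))"
      unfolding c_def
      by (rule prod.reindex_bij_witness[where i = "\<lambda>b. b - 1" and j = Suc]) auto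
    finally have "(\<Prod>b\<in>{1..\<alpha>}. T 1 (?J1 b) (\<kappa> 1 (?J1 b))) * path_det r ?Es vs es =
        contig lc \<alpha> i0 l0" by simp
    also have "\<dots> = T \<alpha> (l0 - i0) (i0 + l0 + int \<alpha>)"
      using \<alpha> by (intro contig_lc) simp
    also have "l0 - i0 = j" using i0 l0 by linarith
    also have "i0 + l0 + int \<alpha> = k" using i0 l0 by linarith
    finally show ?thesis .
  qed
  ultimately show ?thesis by simp
qed

end

theorem mainTheorem10:
  fixes r \<alpha> :: nat
    and \<kappa> :: "nat \<Rightarrow> int \<Rightarrow> int"
    and T :: "nat \<Rightarrow> int \<Rightarrow> int \<Rightarrow> 'c::field_char_0 ratfun"
    and d :: "nat \<Rightarrow> int \<Rightarrow> diagonal"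
    and j k M_minus M_plus :: int
  assumes "r \<ge> 1"
    and "admissible_boundary r \<kappa>"
    and "T_system r T"
    and "\<forall>\<beta>\<in>{1..r}. \<forall>i. T \<beta> i (\<kappa> \<beta> i) = indet \<beta> i"
    and "admissible_diagonals r \<kappa> d"
    and "\<alpha> \<in> {1..r}"
    and "even (int \<alpha> + j + k)"
    and "\<forall>a\<in>{1..\<alpha>}. \<forall>b\<in>{1..\<alpha>}.
           k + int a + int b - int \<alpha> - 1 \<ge> \<kappa> 1 (j - int a + int b)"
    and "\<forall>a\<in>{1..\<alpha>}. \<forall>b\<in>{1..\<alpha>}. j0 \<kappa> \<alpha> j k a \<le> j1 \<kappa> \<alpha> j k b"
    and "M_minus \<le> Min (j0 \<kappa> \<alpha> j k ` {1..\<alpha>})"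
    and "M_plus \<ge> Max (j1 \<kappa> \<alpha> j k ` {1..\<alpha>})"
  defines "Es \<equiv> slice_factors r \<kappa> T d M_minus M_plus"
    and "pos \<equiv> (\<lambda>t. length (slice_factors r \<kappa> T d M_minus t))"
  shows "T \<alpha> j k =
    (\<Prod>b\<in>{1..\<alpha>}. T 1 (j1 \<kappa> \<alpha> j k b) (\<kappa> 1 (j1 \<kappa> \<alpha> j k b))) *
    (\<Sum>F\<in>disjoint_path_families (network r Es) \<alpha>
          {(pos (j0 \<kappa> \<alpha> j k a), 1) | a. a \<in> {1..\<alpha>}}
          {(pos (j1 \<kappa> \<alpha> j k b), 1) | b. b \<in> {1..\<alpha>}}.
        family_weight Es F)"
proof -
  interpret T_boundary r T \<kappa> d
    using assms(1,3) T_nonzero[OF assms(2-4)] assms(2,5) by unfold_locales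
  have \<alpha>: "1 \<le> \<alpha>" "\<alpha> \<le> r" using assms(6) by auto
  have "M_minus \<le> j0 \<kappa> \<alpha> j k a" if "a \<in> {1..\<alpha>}" for a
    using assms(10) that by (meson Min_le finite_atLeastAtMost finite_imageI imageI order_trans)
  moreover have "j1 \<kappa> \<alpha> j k b \<le> M_plus" if "b \<in> {1..\<alpha>}" for b
    using assms(11) that by (meson Max_ge finite_atLeastAtMost finite_imageI imageI order_trans)
  ultimately show ?thesis
    using T_eq_families_sum[OF \<alpha> assms(7)] assms(9)
    unfolding families_sum_def Es_def pos_def by blast
qed

end
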